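(* Let $f:\mathbb{R}^d\to\mathbb{R}\cup\{\infty\}$ be convex and $\ell$-smooth, attaining its minimum at $x^*\in\mathbb{R}^d$, let $x^0\in\mathcal{X}$, $\Delta:=f(x^0)-f(x^* )$, and $R:=\|x^0-x^*\|>0$. Let $\psi:\mathbb{R}_+\to\mathbb{R}_+$, $\psi(x)=\frac{x^2}{2\ell(4x)}$ (not necessarily strictly increasing), and let $\Delta_{\max}\in(0,\infty]$ be the largest value such that $\psi$ is strictly increasing on $[0,\Delta_{\max})$. For $\delta\in[0,\psi(\Delta_{\max}))$ let $\Delta_{\mathrm{left}}(\delta)\in[0,\Delta_{\max})$ be the unique point and $\Delta_{\mathrm{right}}(\delta)\in[\Delta_{\max},\infty]$ the smallest point such that $\psi(\Delta_{\mathrm{left}}(\delta))=\delta$ and $\psi(\Delta_{\mathrm{right}}(\delta))=\delta$ (with $\Delta_{\mathrm{right}}(\delta)=\infty$ if $\{x\in[\Delta_{\max},\infty):\psi(x)=\delta\}$ is empty). Let $$M_{R}:=\max_{f(x)-f(x^* )\le\Delta,\ \|x-x^*\|\le 2R}\|\nabla f(x)\|$$ (or let $M_{R}$ be any upper bound on this maximum), and $$Q:=\left\{\delta\in\left[0,\tfrac12\psi(\Delta_{\max})\right]:\ \ell(4\Delta_{\mathrm{left}}(\delta))\le 2\ell(0),\ \Delta_{\mathrm{right}}(\delta)\ge 2M_{R},\ \delta\le\Delta\right\}.$$ Let $\varepsilon>0$. Then, taking $\bar R=R$ and choosing $\delta\in Q$ to minimize $k(\delta)$ below, the oracle complexity (number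 of gradient calls) required by Algorithm 1 to find an $\varepsilon$-solution is at most (rounded up to an integer) $$\frac{5\sqrt{\ell(0)}\,R}{\sqrt{\varepsilon}}+\min_{\delta\in Q}k(\delta),\qquad k(\delta):=\max\left\{1+\frac12\log_{3/2}\left(\frac{\delta}{8\ell(0)R^2}\right),0\right\}+k_{\mathrm{GD}}(\delta),$$ where $k_{\mathrm{GD}}(\delta)$ is the oracle complexity of GD (Phase 1 of Algorithm 1, started at $x^0$) for finding a point $\bar x$ such that $f(\bar x)-f(x^* )\le\delta/2$; the second term does not depend on $\varepsilon$.
   Context: $\|\cdot\|$ is the Euclidean norm for vectors and the spectral norm for matrices; $\mathbb{R}_+=[0,\infty)$. An $\varepsilon$-solution is a point $\bar x\in\mathbb{R}^d$ with $f(\bar x)-\inf_{x} f(x)\le\varepsilon$. If $\Delta_{\max}=\infty$, then $\psi(\Delta_{\max})$ means $\lim_{x\to\infty}\psi(x)\in(0,\infty]$, $\Delta_{\mathrm{right}}(\delta)=\infty$, and $\delta$ is always finite. Setting: $f:\mathbb{R}^d\to\mathbb{R}\cup\{\infty\}$, $\mathcal{X}:=\{x\in\mathbb{R}^d: f(x)<\infty\}$ is assumed to be an open, $d$-dimensional (nonempty) convex set, and $\bar{\mathcal{X}}$ denotes its closure; $\mathrm{Proj}_{\bar{\mathcal{X}}}$ is the Euclidean projection onto $\bar{\mathcal{X}}$. $f$ is $\ell$-smooth if $f$ is twice differentiable on $\mathcal{X}$, continuous on $\bar{\mathcal{X}}$, and $\ell:[0,\infty)\to(0,\infty)$ is a non-decreasing,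 positive, locally Lipschitz function with $\|\nabla^2 f(x)\|\le \ell(\|\nabla f(x)\|)$ for all $x\in\mathcal{X}$. Algorithm 1 (input: $x^0\in\mathcal{X}$, $\ell$, $\delta$, $\bar R$). Phase 1: starting from $x^0$, run gradient descent (GD) $x^{j+1}=x^j-\eta_j\nabla f(x^j)$ with $\eta_j=\int_0^1\frac{dv}{\ell(\|\nabla f(x^j)\|+\|\nabla f(x^j)\|v)}$ until a point $\bar x$ with $f(\bar x)-f(x^* )\le\delta/2$ is reached. Phase 2: set $y^0=u^0=\bar x$, $\Gamma_0=\delta/\bar R^2$, $\gamma=1/(2\ell(0))$, and for $k=0,1,2,\dots$: $\alpha_k=\sqrt{\gamma\Gamma_k}$; $y^{k+1}=\frac{1}{1+\alpha_k}y^k+\frac{\alpha_k}{1+\alpha_k}u^k-\frac{\gamma}{1+\alpha_k}\nabla f(y^k)$; $u^{k+1}=\mathrm{Proj}_{\bar{\mathcal{X}}}\left(u^k-\frac{\alpha_k}{\Gamma_k}\nabla f(y^{k+1})\right)$; $\Gamma_{k+1}=\Gamma_k/(1+\alpha_k)$. One new gradient is computed per iteration. Conventions for the degenerate value $\delta=0$: $\log 0=-\infty$, $k_{\mathrm{GD}}(0)=\infty$ if GD does not reach a minimizer in finitely many steps, and if it does, the point $\bar x$ is already an $\varepsilon$-solution. *)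

theory Defs
  imports "HOL-Analysis.Analysis"
begin

section \<open>Extended-valued functions, gradients and generalized smoothness\<close>

definition eff_dom :: "('a \<Rightarrow> ereal) \<Rightarrow> 'a set"
  where "eff_dom f = {x. f x < \<infinity>}"

text \<open>The effective domain is open wherever the notions below are used, so the values of
  \<open>real_of_ereal\<close> at infinite arguments do not influence gradients and Hessians inside it.\<close>

definition has_grad :: "('a::real_inner \<Rightarrow> ereal) \<Rightarrow> 'a \<Rightarrow> 'a \<Rightarrow> bool"
  where "has_grad f x g \<longleftrightarrow> GDERIV (\<lambda>z. real_of_ereal (f z)) x :> g"

definition grad :: "('a::real_inner \<Rightarrow> ereal) \<Rightarrow> 'a \<Rightarrow> 'a"
  where "grad f x = (THE g. has_grad f x g)"

definition hessian :: "(real ^ 'n \<Rightarrow> ereal) \<Rightarrow> real ^ 'n \<Rightarrow> real ^ 'n ^ 'n"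
  where "hessian f x = jacobian (grad f) (at x)"

definition twice_differentiable_at :: "(real ^ 'n \<Rightarrow> ereal) \<Rightarrow> real ^ 'n \<Rightarrow> bool"
  where "twice_differentiable_at f x \<longleftrightarrow>
    (\<exists>g. has_grad f x g) \<and> grad f differentiable (at x)"

definition spectral_norm :: "real ^ 'n ^ 'm \<Rightarrow> real"
  where "spectral_norm A = onorm (\<lambda>v. A *v v)"

definition locally_lipschitz_on :: "real set \<Rightarrow> (real \<Rightarrow> real) \<Rightarrow> bool"
  where "locally_lipschitz_on S h \<longleftrightarrow>
    (\<forall>s\<in>S. \<exists>r>0. \<exists>L. L-lipschitz_on (cball s r \<inter> S) h)"

text \<open>Continuity on the closure is continuity as an extended-valued function: when the
  effective domain is open, it forces \<open>f\<close> to tend to infinity at its boundary.\<close>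

definition ell_smooth :: "(real \<Rightarrow> real) \<Rightarrow> (real ^ 'n \<Rightarrow> ereal) \<Rightarrow> bool"
  where "ell_smooth l f \<longleftrightarrow>
    (\<forall>x\<in>eff_dom f. twice_differentiable_at f x) \<and>
    continuous_on (closure (eff_dom f)) f \<and>
    mono_on {0..} l \<and> (\<forall>s\<ge>0. 0 < l s) \<and> locally_lipschitz_on {0..} l \<and>
    (\<forall>x\<in>eff_dom f. spectral_norm (hessian f x) \<le> l (norm (grad f x)))"

definition eps_solution :: "('a \<Rightarrow> ereal) \<Rightarrow> real \<Rightarrow> 'a \<Rightarrow> bool"
  where "eps_solution f \<epsilon> x \<longleftrightarrow> f x - (INF z. f z) \<le> ereal \<epsilon>"


section \<open>The two phases of the algorithm\<close>

definition gd_step_size :: "(real \<Rightarrow> real) \<Rightarrow> real \<Rightarrow> real"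
  where "gd_step_size l s = integral {0..1} (\<lambda>v. 1 / l (s + s * v))"

primrec gd_iter :: "(real ^ 'n \<Rightarrow> ereal) \<Rightarrow> (real \<Rightarrow> real) \<Rightarrow> real ^ 'n \<Rightarrow> nat \<Rightarrow> real ^ 'n"
  where
    "gd_iter f l x0 0 = x0"
  | "gd_iter f l x0 (Suc j) =
      (let x = gd_iter f l x0 j
       in x - gd_step_size l (norm (grad f x)) *\<^sub>R grad f x)"

text \<open>The state of the second phase after \<open>k\<close> iterations is the triple
  \<open>(y\<^sup>k, u\<^sup>k, \<Gamma>\<^sub>k)\<close>.\<close>

primrec agd_state :: "(real ^ 'n \<Rightarrow> ereal) \<Rightarrow> (real \<Rightarrow> real) \<Rightarrow> real \<Rightarrow> real \<Rightarrow> real ^ 'n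
    \<Rightarrow> nat \<Rightarrow> (real ^ 'n) \<times> (real ^ 'n) \<times> real"
  where
    "agd_state f l \<delta> Rbar xbar 0 = (xbar, xbar, \<delta> / Rbar\<^sup>2)"
  | "agd_state f l \<delta> Rbar xbar (Suc k) =
      (let (y, u, \<Gamma>) = agd_state f l \<delta> Rbar xbar k;
           \<gamma> = 1 / (2 * l 0);
           \<alpha> = sqrt (\<gamma> * \<Gamma>);
           y' = (1 / (1 + \<alpha>)) *\<^sub>R y + (\<alpha> / (1 + \<alpha>)) *\<^sub>R u - (\<gamma> / (1 + \<alpha>)) *\<^sub>R grad f y;
           u' = closest_point (closure (eff_dom f)) (u - (\<alpha> / \<Gamma>) *\<^sub>R grad f y')
       in (y', u', \<Gamma> / (1 + \<alpha>)))"

definition agd_iter :: "(real ^ 'n \<Rightarrow> ereal) \<Rightarrow> (real \<Rightarrow> real) \<Rightarrow> real \<Rightarrow> real \<Rightarrow> real ^ 'n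
    \<Rightarrow> nat \<Rightarrow> real ^ 'n"
  where "agd_iter f l \<delta> Rbar xbar k = fst (agd_state f l \<delta> Rbar xbar k)"

text \<open>Counting convention: the iterate \<open>x\<^sup>j\<close> costs the \<open>j\<close> gradients at
  \<open>x\<^sup>0, \<dots>, x\<^sup>j\<^sup>-\<^sup>1\<close>. A gradient is available only inside the effective domain, so a query
  outside of it makes the run fail. The values below are infinite if the target is
  never reached.\<close>

definition k_GD :: "(real ^ 'n \<Rightarrow> ereal) \<Rightarrow> (real \<Rightarrow> real) \<Rightarrow> real ^ 'n \<Rightarrow> real ^ 'n \<Rightarrow> real \<Rightarrow> enat"
  where "k_GD f l xstar x0 \<delta> =
    (INF j\<in>{j. (\<forall>i<j. gd_iter f l x0 i \<in> eff_dom f) \<and>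
               f (gd_iter f l x0 j) - f xstar \<le> ereal (\<delta> / 2)}. enat j)"

text \<open>If the first phase stops at \<open>x\<^sup>J\<close>, the iterate \<open>y\<^sup>K\<close> of the second phase costs
  \<open>J + K\<close> gradients in total: those at \<open>x\<^sup>0, \<dots>, x\<^sup>J\<^sup>-\<^sup>1\<close> and at \<open>y\<^sup>0, \<dots>, y\<^sup>K\<^sup>-\<^sup>1\<close>.
  (The gradient at \<open>y\<^sup>k\<^sup>+\<^sup>1\<close> used for \<open>u\<^sup>k\<^sup>+\<^sup>1\<close> is reused in the next iteration.)\<close>

definition alg_oracle_complexity ::
    "(real ^ 'n \<Rightarrow> ereal) \<Rightarrow> (real \<Rightarrow> real) \<Rightarrow> real ^ 'n \<Rightarrow> real ^ 'n \<Rightarrow> real \<Rightarrow> real \<Rightarrow> real \<Rightarrow> enat"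
  where "alg_oracle_complexity f l xstar x0 \<delta> Rbar \<epsilon> =
    (INF (J, K)\<in>{(J, K). enat J = k_GD f l xstar x0 \<delta> \<and>
        (\<forall>k<K. agd_iter f l \<delta> Rbar (gd_iter f l x0 J) k \<in> eff_dom f) \<and>
        eps_solution f \<epsilon> (agd_iter f l \<delta> Rbar (gd_iter f l x0 J) K)}. enat (J + K))"


section \<open>The quantities in the bound\<close>

definition psi :: "(real \<Rightarrow> real) \<Rightarrow> real \<Rightarrow> real"
  where "psi l x = x\<^sup>2 / (2 * l (4 * x))"

definition Delta_max :: "(real \<Rightarrow> real) \<Rightarrow> ereal"
  where "Delta_max l =
    (GREATEST D. 0 < D \<and> strict_mono_on {x. 0 \<le> x \<and> ereal x < D} (psi l))"

definition psi_Delta_max :: "(real \<Rightarrow> real) \<Rightarrow> ereal"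
  where "psi_Delta_max l =
    (if Delta_max l = \<infinity> then Lim at_top (\<lambda>x. ereal (psi l x))
     else ereal (psi l (real_of_ereal (Delta_max l))))"

definition Delta_left :: "(real \<Rightarrow> real) \<Rightarrow> real \<Rightarrow> real"
  where "Delta_left l \<delta> = (THE x. 0 \<le> x \<and> ereal x < Delta_max l \<and> psi l x = \<delta>)"

definition Delta_right :: "(real \<Rightarrow> real) \<Rightarrow> real \<Rightarrow> ereal"
  where "Delta_right l \<delta> =
    (if \<exists>x. Delta_max l \<le> ereal x \<and> psi l x = \<delta>
     then ereal (LEAST x. Delta_max l \<le> ereal x \<and> psi l x = \<delta>)
     else \<infinity>)"

definition Q_set :: "(real \<Rightarrow> real) \<Rightarrow> real \<Rightarrow> real \<Rightarrow> real set"
  where "Q_set l \<Delta> M =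
    {\<delta>. 0 \<le> \<delta> \<and> ereal \<delta> \<le> psi_Delta_max l / 2 \<and>
        l (4 * Delta_left l \<delta>) \<le> 2 * l 0 \<and>
        ereal (2 * M) \<le> Delta_right l \<delta> \<and>
        \<delta> \<le> \<Delta>}"

text \<open>The library logarithm has the value 0 at 0, whereas the convention here is
  that it is minus infinity.\<close>

definition elog :: "real \<Rightarrow> real \<Rightarrow> ereal"
  where "elog b x = (if x = 0 then -\<infinity> else ereal (log b x))"

definition k_total :: "(real ^ 'n \<Rightarrow> ereal) \<Rightarrow> (real \<Rightarrow> real) \<Rightarrow> real ^ 'n \<Rightarrow> real ^ 'n \<Rightarrow> real
    \<Rightarrow> real \<Rightarrow> ereal"
  where "k_total f l xstar x0 R \<delta> =
    max (1 + ereal (1 / 2) * elog (3 / 2) (\<delta> / (8 * l 0 * R\<^sup>2))) 0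
    + ereal_of_enat (k_GD f l xstar x0 \<delta>)"

definition round_up :: "ereal \<Rightarrow> enat"
  where "round_up b = (LEAST n. b \<le> ereal_of_enat n)"

end

theory Submission
  imports Defs
begin

text \<open>
  If \<open>l s \<le> L\<close> and the gradients involved have norm at most \<open>s\<close>, then \<open>f\<close> behaves like an
  \<open>L\<close>-smooth convex function, and is in particular cocoercive with constant \<open>1 / L\<close>. Cocoercivity at the
  minimizer shows that gradient descent does not increase the distance to it, and that
  \<open>psi l (norm (grad f x)) \<le> f x - f xstar\<close>. Hence \<open>f x - f xstar \<le> \<delta>\<close> confines the gradient norm
  to \<open>[0, Delta_left \<delta>]\<close> or to a range that is separated from it by a gap; for the first point of
  phase 2 the latter is excluded by \<open>M\<close>.

  In phase 2 the potential \<open>f y - f xstar + \<Gamma> / 2 * (norm (u - xstar))\<^sup>2\<close> contracts by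
  \<open>1 / (1 + \<alpha>)\<close>, just as \<open>\<Gamma>\<close> does, as long as the gradients at consecutive points are at most
  \<open>Delta_left \<delta>\<close>, where the effective smoothness constant is \<open>2 * l 0\<close>. That the next point is of this kind
  follows by moving the coupling parameter continuously from 0 to \<open>\<alpha>\<close>: the contraction keeps the
  function value below \<open>\<delta>\<close>, so the gradient norm cannot jump over the gap. The count then comes from
  \<open>\<alpha>\<^sub>k\<^sub>+\<^sub>1 = \<alpha>\<^sub>k / sqrt (1 + \<alpha>\<^sub>k)\<close>, which decays geometrically while \<open>\<alpha>\<^sub>k > 2\<close> and then at least as
  fast as \<open>3 / k\<close>.
\<close>

section \<open>Functions with gradient-dependent smoothness\<close>

locale ell_smooth_convex =
  fixes f :: "real ^ 'n \<Rightarrow> ereal" and l :: "real \<Rightarrow> real"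
  assumes proper: "\<And>x. f x \<noteq> -\<infinity>"
    and open_dom: "open (eff_dom f)"
    and convex_dom: "convex (eff_dom f)"
    and convex_f: "convex_on (eff_dom f) (\<lambda>x. real_of_ereal (f x))"
    and smooth: "ell_smooth l f"
begin

abbreviation "X \<equiv> eff_dom f"
abbreviation "F \<equiv> \<lambda>x. real_of_ereal (f x)"

section \<open>Derivatives, tangents, short steps and cocoercivity\<close>

lemma l_mono: "0 \<le> s \<Longrightarrow> s \<le> t \<Longrightarrow> l s \<le> l t"
  using smooth by (auto simp: ell_smooth_def mono_on_def)

lemma l_pos: "0 \<le> s \<Longrightarrow> 0 < l s"
  using smooth by (auto simp: ell_smooth_def)

lemma f_eq_ereal: "x \<in> X \<Longrightarrow> f x = ereal (F x)"
  using proper[of x] by (cases "f x") (auto simp: eff_dom_def)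

lemma has_derivative_F:
  assumes "x \<in> X"
  shows "(F has_derivative (\<lambda>h. h \<bullet> grad f x)) (at x)"
proof -
  obtain g where g: "has_grad f x g"
    using smooth assms by (auto simp: ell_smooth_def twice_differentiable_at_def)
  have "grad f x = g"
    unfolding grad_def
  proof (rule the_equality[where P = "has_grad f x", OF g])
    fix g' assume "has_grad f x g'"
    then have "(\<lambda>h. h \<bullet> g') = (\<lambda>h. h \<bullet> g)"
      using g unfolding has_grad_def gderiv_def by (rule has_derivative_unique)
    then show "g' = g"
      by (metis inner_commute vector_eq_ldot)
  qed
  then show ?thesis
    using g by (simp add: has_grad_def gderiv_def)
qed

lemma has_derivative_grad:
  assumes "x \<in> X"
  shows "(grad f has_derivative (\<lambda>h. hessian f x *v h)) (at x)"
  using smooth assms jacobian_works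
  by (auto simp: ell_smooth_def twice_differentiable_at_def hessian_def)

lemma onorm_hessian_le: "x \<in> X \<Longrightarrow> onorm (\<lambda>h. hessian f x *v h) \<le> l (norm (grad f x))"
  using smooth by (auto simp: ell_smooth_def spectral_norm_def)

lemma continuous_on_grad: "continuous_on X (grad f)"
  by (intro continuous_at_imp_continuous_on ballI) (rule has_derivative_continuous[OF has_derivative_grad])

lemma has_real_derivative_along:
  assumes "x + t *\<^sub>R d \<in> X"
  shows "((\<lambda>t. F (x + t *\<^sub>R d)) has_real_derivative d \<bullet> grad f (x + t *\<^sub>R d)) (at t)"
proof -
  have "((\<lambda>t. x + t *\<^sub>R d) has_derivative (\<lambda>h. h *\<^sub>R d)) (at t)"
    by (auto intro!: derivative_eq_intros)
  from has_derivative_compose[OF this has_derivative_F[OF assms]]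
  show ?thesis
    by (simp add: has_field_derivative_def mult.commute mult_commute_abs)
qed

text \<open>On the line through \<open>x\<close> and \<open>y\<close> this is the one-dimensional
  tangent inequality; openness of \<open>eff_dom f\<close> makes the parameter set \<open>A\<close>
  open, so 0 is an interior point of it.\<close>

lemma F_above_tangent:
  assumes x: "x \<in> X" and y: "y \<in> X"
  shows "F x + (y - x) \<bullet> grad f x \<le> F y"
proof -
  define p where "p t = x + t *\<^sub>R (y - x)" for t :: real
  define A where "A = p -` X"
  have "open A"
    unfolding A_def p_def by (intro open_vimage open_dom continuous_intros)
  have p_comb: "p ((1 - u) *\<^sub>R s + u *\<^sub>R t) = (1 - u) *\<^sub>R p s + u *\<^sub>R p t" for u s t
    by (simp add: p_def algebra_simps)
  have "convex A"
    unfolding convex_alt A_def vimage_def mem_Collect_eq p_comb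
    using convex_dom unfolding convex_alt by blast
  have "convex_on A (\<lambda>t. F (p t))"
  proof (rule convex_onI)
    fix u s t :: real assume "0 < u" "u < 1" "s \<in> A" "t \<in> A"
    then show "F (p ((1 - u) *\<^sub>R s + u *\<^sub>R t)) \<le> (1 - u) * F (p s) + u * F (p t)"
      unfolding p_comb using convex_onD[OF convex_f, of u "p s" "p t"] by (simp add: A_def)
  qed fact
  moreover have "0 \<in> A" "1 \<in> A"
    using x y by (auto simp: A_def p_def)
  moreover have "((\<lambda>t. F (p t)) has_field_derivative (y - x) \<bullet> grad f x) (at 0 within A)"
    using has_real_derivative_along[of x 0 "y - x"] x
    by (auto simp: p_def intro: has_field_derivative_at_within)
  ultimately have "F (p 1) - F (p 0) \<ge> (y - x) \<bullet> grad f x * (1 - 0)"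
    using \<open>open A\<close> \<open>convex A\<close>
    by (intro convex_on_imp_above_tangent[of A]) (auto simp: interior_open convex_connected)
  then show ?thesis
    by (simp add: p_def)
qed

text \<open>The key a priori estimate: on a step that is short compared with \<open>1 / L\<close>, the gradient
  norm stays below \<open>s\<close>, so that \<open>f\<close> stays finite along the step and the Hessian norm is
  bounded by \<open>L\<close>.\<close>

lemma grad_along_short_step:
  assumes x: "x \<in> X" and s: "0 \<le> s" "norm (grad f x) + L * norm d \<le> s" and L: "l s \<le> L"
    and t: "0 \<le> t" "t \<le> 1"
  shows "x + t *\<^sub>R d \<in> X \<and> norm (grad f (x + t *\<^sub>R d) - grad f x) \<le> L * t * norm d"
proof (cases "d = 0")
  case True
  then show ?thesis
    using x by simp
next
  case False
  define z where "z t = x + t *\<^sub>R d" for t :: real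
  \<comment> \<open>\<open>good\<close> concerns the whole initial piece of the path, so that the
    mean value inequality applies to it. This is a continuation argument: the supremum
    \<open>T\<close> of the good parameters is good, and \<open>T < 1\<close> would make the
    gradient bound strict and leave room to go on.\<close>
  define good where "good t \<longleftrightarrow> (\<forall>r\<in>{0..t}. z r \<in> X \<and> norm (grad f (z r)) \<le> s)" for t
  have cont_z: "continuous_on S z" for S
    unfolding z_def by (intro continuous_intros)
  have "0 < L"
    using l_pos[OF s(1)] L by linarith
  have bound: "norm (grad f (z t) - grad f x) \<le> L * t * norm d" if "good t" "0 \<le> t" for t
  proof -
    have seg: "closed_segment x (z t) = z ` {0..t}"
    proof (cases "t = 0")
      case False
      have "\<exists>u\<in>{0..1}. r = u * t" if "r \<in> {0..t}" for r
        using that False by (intro bexI[of _ "r / t"]) auto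
      moreover have "u * t \<in> {0..t}" if "u \<in> {0..1}" for u
        using that \<open>0 \<le> t\<close> by (auto simp: mult_left_le_one_le)
      ultimately have "{0..t} = (\<lambda>u. u * t) ` {0..1}"
        by blast
      then show ?thesis
        by (simp add: closed_segment_image_interval image_image z_def algebra_simps)
    qed (auto simp: z_def)
    have in_X: "w \<in> X" and le_s: "norm (grad f w) \<le> s" if "w \<in> closed_segment x (z t)" for w
      using that \<open>good t\<close> unfolding seg good_def by auto
    have "norm (grad f (z t) - grad f x) \<le> L * norm (z t - x)"
    proof (rule differentiable_bound)
      fix w assume w: "w \<in> closed_segment x (z t)"
      show "(grad f has_derivative (\<lambda>h. hessian f w *v h)) (at w within closed_segment x (z t))"
        using has_derivative_grad[OF in_X[OF w]] by (rule has_derivative_at_withinI)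
      have "l (norm (grad f w)) \<le> l s"
        using le_s[OF w] by (intro l_mono) auto
      then show "onorm (\<lambda>h. hessian f w *v h) \<le> L"
        using onorm_hessian_le[OF in_X[OF w]] L by linarith
    qed auto
    then show ?thesis
      using \<open>0 \<le> t\<close> by (simp add: z_def mult.assoc)
  qed
  define A where "A = {t\<in>{0..1}. good t}"
  define T where "T = Sup A"
  have "0 \<in> A"
  proof -
    have "0 \<le> L * norm d"
      using \<open>0 < L\<close> by simp
    then have "norm (grad f x) \<le> s"
      using s(2) by linarith
    then show ?thesis
      using x by (auto simp: A_def good_def z_def)
  qed
  have bdd: "bdd_above A"
    by (auto simp: A_def intro!: bdd_aboveI[of _ 1])
  have "0 \<le> T"
    unfolding T_def using \<open>0 \<in> A\<close> bdd by (rule cSup_upper)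
  moreover have "T \<le> 1"
    unfolding T_def
  proof (rule cSup_least)
    show "A \<noteq> {}" using \<open>0 \<in> A\<close> by blast
    show "t \<le> 1" if "t \<in> A" for t using that by (simp add: A_def)
  qed
  ultimately have T: "0 \<le> T" "T \<le> 1" .
  have before: "z r \<in> X" "norm (grad f (z r)) \<le> s" if r: "0 \<le> r" "r < T" for r
  proof -
    obtain t where "t \<in> A" "r < t"
      using less_cSupD[of A r] \<open>0 \<in> A\<close> r unfolding T_def by blast
    then show "z r \<in> X" "norm (grad f (z r)) \<le> s"
      using r by (auto simp: A_def good_def)
  qed
  have T_good: "z T \<in> X" "norm (grad f (z T)) \<le> s"
  proof -
    have *: "z T \<in> X \<and> norm (grad f (z T)) \<le> s"
    proof (cases "T = 0")
      case True
      then show ?thesis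
        using \<open>0 \<in> A\<close> by (auto simp: A_def good_def)
    next
      case False
      then have "T > 0" using T by simp
      then have cl: "closure {0..<T} = {0..T}" by simp
      have sub: "z ` {0..T} \<subseteq> closure X"
        unfolding cl[symmetric]
        using before(1) closure_subset[of X]
        by (intro image_closure_subset[OF cont_z]) (auto simp: image_subset_iff)
      \<comment> \<open>Before \<open>T\<close> the slope along the path is at most
        \<open>s * norm d\<close>. The resulting bound \<open>c\<close> passes to the limit since
        \<open>f\<close> is continuous on the closure as an extended-valued function, so
        \<open>z T\<close> cannot be a boundary point of infinite value.\<close>
      define c where "c = F x + s * norm d"
      have below: "F (z t) \<le> c" if t: "0 \<le> t" "t < T" for t
      proof (cases "t = 0")
        case False
        then have "0 < t" using t by simp
        have "\<exists>w. w > 0 \<and> w < t \<and> F (z t) - F (z 0) = (t - 0) * (d \<bullet> grad f (z w))"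
        proof (rule MVT2[OF \<open>0 < t\<close>])
          fix w assume "0 \<le> w" "w \<le> t"
          then show "((\<lambda>t. F (z t)) has_real_derivative d \<bullet> grad f (z w)) (at w)"
            unfolding z_def using before[of w] t
            by (intro has_real_derivative_along) (auto simp: z_def)
        qed
        then obtain w where w: "0 < w" "w < t" "F (z t) - F (z 0) = t * (d \<bullet> grad f (z w))"
          by auto
        have "d \<bullet> grad f (z w) \<le> norm d * norm (grad f (z w))"
          by (rule norm_cauchy_schwarz)
        also have "\<dots> \<le> norm d * s"
          using before[of w] w t by (intro mult_left_mono) auto
        finally have 1: "d \<bullet> grad f (z w) \<le> s * norm d"
          by (simp add: mult.commute)
        have "t * (d \<bullet> grad f (z w)) \<le> t * (s * norm d)"
          using 1 t by (intro mult_left_mono) auto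
        also have "\<dots> \<le> 1 * (s * norm d)"
          using t T s by (intro mult_right_mono) auto
        finally show ?thesis
          using w(3) by (simp add: c_def z_def)
      qed (use s in \<open>auto simp: c_def z_def\<close>)
      have "continuous_on (closure {0..<T}) (f \<circ> z)"
        unfolding cl using smooth sub
        by (intro continuous_on_compose cont_z) (auto simp: ell_smooth_def intro: continuous_on_subset)
      then have "(f \<circ> z) ` closure {0..<T} \<subseteq> {..ereal c}"
      proof (intro image_closure_subset)
        show "(f \<circ> z) ` {0..<T} \<subseteq> {..ereal c}"
        proof (rule image_subsetI)
          fix t assume t: "t \<in> {0..<T}"
          then have "z t \<in> X" "F (z t) \<le> c"
            using before below by auto
          then show "(f \<circ> z) t \<in> {..ereal c}"
            by (subst comp_apply, subst f_eq_ereal) auto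
        qed
      qed auto
      moreover have "T \<in> closure {0..<T}"
        using T unfolding cl by simp
      ultimately have "f (z T) \<le> ereal c"
        by (auto simp: image_subset_iff)
      then have zT: "z T \<in> X"
        by (auto simp: eff_dom_def intro: order.strict_trans1)
      have "z ` {0..T} \<subseteq> X"
        using before zT by (auto simp: image_subset_iff) (metis less_eq_real_def)
      then have "continuous_on (closure {0..<T}) (\<lambda>t. norm (grad f (z t)))"
        unfolding cl
        by (intro continuous_on_norm continuous_on_compose2[OF continuous_on_grad cont_z])
      then have "(\<lambda>t. norm (grad f (z t))) ` closure {0..<T} \<subseteq> {..s}"
        using before by (intro image_closure_subset) (auto simp: image_subset_iff)
      then show ?thesis
        using zT \<open>T \<in> closure _\<close> by (auto simp: image_subset_iff)
    qed
    then show "z T \<in> X" "norm (grad f (z T)) \<le> s" by auto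
  qed
  have good_T: "good T"
    using before T_good unfolding good_def by (metis atLeastAtMost_iff less_eq_real_def)
  have "T = 1"
  proof (rule ccontr)
    assume "T \<noteq> 1"
    then have "T < 1" using T by simp
    have "norm (grad f (z T)) \<le> norm (grad f x) + norm (grad f (z T) - grad f x)"
      by (rule norm_triangle_sub)
    also have "\<dots> \<le> norm (grad f x) + L * T * norm d"
      using bound[OF good_T T(1)] by simp
    also have "\<dots> < norm (grad f x) + L * norm d"
      using \<open>0 < L\<close> \<open>T < 1\<close> False by simp
    finally have less: "norm (grad f (z T)) < s"
      using s by simp
    define U where "U = {w\<in>X. norm (grad f w) < s}"
    have "open U"
      unfolding U_def
      using continuous_open_preimage[OF continuous_on_norm[OF continuous_on_grad] open_dom open_lessThan]
      by (simp add: vimage_def Int_def)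
    then have "open (z -` U)"
      using cont_z by (rule open_vimage)
    moreover have "T \<in> z -` U"
      using less T_good by (simp add: U_def)
    ultimately obtain e where e: "e > 0" "ball T e \<subseteq> z -` U"
      unfolding open_contains_ball by blast
    define t where "t = min 1 (T + e / 2)"
    have "T < t" "t \<le> 1" "t < T + e"
      using e \<open>T < 1\<close> by (auto simp: t_def min_def)
    have "good t"
      unfolding good_def
    proof
      fix r assume r: "r \<in> {0..t}"
      show "z r \<in> X \<and> norm (grad f (z r)) \<le> s"
      proof (cases "r \<le> T")
        case True
        then show ?thesis using good_T r by (auto simp: good_def)
      next
        case False
        then have "r \<in> ball T e"
          using r \<open>t < T + e\<close> by (auto simp: dist_real_def)
        then show ?thesis using e by (auto simp: U_def)
      qed
    qed
    then have "t \<in> A"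
      using T \<open>T < t\<close> \<open>t \<le> 1\<close> by (auto simp: A_def)
    then show False
      using cSup_upper[OF _ bdd, of t] \<open>T < t\<close> by (simp add: T_def)
  qed
  have "good t"
    using good_T t unfolding good_def \<open>T = 1\<close> by auto
  then have "z t \<in> X"
    using t by (auto simp: good_def)
  then show ?thesis
    using bound[OF \<open>good t\<close> t(1)] by (simp add: z_def)
qed

text \<open>The descent lemma: up to a constant, \<open>\<phi>\<close> is \<open>F\<close> along the
  step minus its quadratic model, and the gradient bound along short steps makes its derivative
  nonpositive.\<close>

lemma F_short_step_le:
  assumes x: "x \<in> X" and s: "0 \<le> s" "norm (grad f x) + L * norm d \<le> s" and L: "l s \<le> L"
  shows "F (x + d) \<le> F x + d \<bullet> grad f x + L / 2 * (norm d)\<^sup>2"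
proof -
  define \<phi> where "\<phi> t = F (x + t *\<^sub>R d) - t * (d \<bullet> grad f x) - L / 2 * t\<^sup>2 * (norm d)\<^sup>2" for t
  have "\<phi> 1 \<le> \<phi> 0"
  proof (rule DERIV_nonpos_imp_nonincreasing[of 0 1])
    fix t :: real assume t: "0 \<le> t" "t \<le> 1"
    note step = grad_along_short_step[OF x s L t]
    have "(\<phi> has_real_derivative
        d \<bullet> grad f (x + t *\<^sub>R d) - d \<bullet> grad f x - L * t * (norm d)\<^sup>2) (at t)"
      unfolding \<phi>_def using step
      by (auto intro!: derivative_eq_intros has_real_derivative_along)
    moreover have "d \<bullet> (grad f (x + t *\<^sub>R d) - grad f x) \<le> norm d * (L * t * norm d)"
      using step by (intro order_trans[OF norm_cauchy_schwarz] mult_left_mono) auto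
    ultimately show "\<exists>y. (\<phi> has_real_derivative y) (at t) \<and> y \<le> 0"
      by (intro exI[of _ "d \<bullet> grad f (x + t *\<^sub>R d) - d \<bullet> grad f x - L * t * (norm d)\<^sup>2"])
        (auto simp: inner_diff_right power2_eq_square algebra_simps)
  qed simp
  then show ?thesis
    by (simp add: \<phi>_def)
qed

text \<open>The point \<open>x + d\<close> is one gradient step from \<open>x\<close> for
  \<open>F\<close> minus its tangent at \<open>y\<close>. There the tangent at \<open>y\<close>
  bounds \<open>F\<close> from below and the descent lemma bounds it from above. As
  \<open>L * norm d\<close> is the norm of the gradient difference, the hypothesis on
  \<open>s\<close> is what makes the step short.\<close>

lemma F_cocoercive:
  assumes x: "x \<in> X" and y: "y \<in> X"
    and s: "norm (grad f x) + norm (grad f x - grad f y) \<le> s" and L: "l s \<le> L"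
  shows "F y + (x - y) \<bullet> grad f y + (norm (grad f x - grad f y))\<^sup>2 / (2 * L) \<le> F x"
proof -
  define h where "h = grad f x - grad f y"
  define d where "d = - (1 / L) *\<^sub>R h"
  have "0 \<le> s"
    using s by (meson add_nonneg_nonneg norm_ge_zero order_trans)
  then have "0 < L"
    using l_pos[of s] L by linarith
  have *: "norm (grad f x) + L * norm d \<le> s"
    using s \<open>0 < L\<close> by (simp add: d_def h_def)
  have "x + d \<in> X"
    using grad_along_short_step[OF x \<open>0 \<le> s\<close> * L, of 1] by simp
  have "F y + (x + d - y) \<bullet> grad f y \<le> F x + d \<bullet> grad f x + L / 2 * (norm d)\<^sup>2"
    using F_above_tangent[OF y \<open>x + d \<in> X\<close>] F_short_step_le[OF x \<open>0 \<le> s\<close> * L] by linarith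
  then have "F y + (x - y) \<bullet> grad f y - d \<bullet> h - L / 2 * (norm d)\<^sup>2 \<le> F x"
    by (simp add: h_def inner_simps)
  moreover have "d \<bullet> h = - (norm h)\<^sup>2 / L"
    by (simp add: d_def power2_norm_eq_inner)
  moreover have "L / 2 * (norm d)\<^sup>2 = (norm h)\<^sup>2 / (2 * L)"
    using \<open>0 < L\<close> by (simp add: d_def power_divide power2_eq_square)
  ultimately show ?thesis
    by (simp add: h_def[symmetric] field_simps)
qed

end

section \<open>The step size of gradient descent\<close>

lemma gd_step_size_bounds:
  assumes mono: "mono_on {0..} l" and pos: "\<And>s. 0 \<le> s \<Longrightarrow> 0 < l s" and s: "0 \<le> s"
  shows "0 \<le> gd_step_size l s" "gd_step_size l s \<le> 1 / l s"
proof -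
  have l_ge: "0 < l s" "l s \<le> l (s + s * v)" if "v \<in> {0..1}" for v
    using that s pos[of s] by (auto intro!: mono_onD[OF mono])
  have "0 \<le> gd_step_size l s \<and> gd_step_size l s \<le> 1 / l s"
  proof (cases "(\<lambda>v. 1 / l (s + s * v)) integrable_on {0..1}")
    case True
    have "integral {0..1} (\<lambda>v. 1 / l (s + s * v)) \<le> integral {0..1} (\<lambda>v :: real. 1 / l s)"
      using True l_ge by (intro integral_le) (auto intro!: divide_left_mono mult_pos_pos dest: less_le_trans)
    moreover have "0 \<le> integral {0..1} (\<lambda>v. 1 / l (s + s * v))"
      using True l_ge by (intro integral_nonneg) (auto dest: less_le_trans intro: less_imp_le)
    ultimately show ?thesis
      by (simp add: gd_step_size_def)
  \<comment> \<open>A non-integrable integrand gives the default value 0, which satisfies both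
    bounds.\<close>
  qed (use pos[OF s] in \<open>simp add: gd_step_size_def not_integrable_integral\<close>)
  then show "0 \<le> gd_step_size l s" "gd_step_size l s \<le> 1 / l s" by auto
qed

section \<open>Consequences of a minimizer for the two phases\<close>

locale ell_smooth_convex_min = ell_smooth_convex f l
  for f :: "real ^ 'n \<Rightarrow> ereal" and l :: "real \<Rightarrow> real" +
  fixes xstar :: "real ^ 'n"
  assumes dom_nonempty: "eff_dom f \<noteq> {}"
    and minimum: "\<And>x. f xstar \<le> f x"
begin

lemma xstar_in_dom: "xstar \<in> X"
  using dom_nonempty minimum by (fastforce simp: eff_dom_def intro: le_less_trans)

lemma F_xstar_le: "x \<in> X \<Longrightarrow> F xstar \<le> F x"
  using minimum[of x] f_eq_ereal[of x] f_eq_ereal[OF xstar_in_dom] by (metis ereal_less_eq(3))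

lemma f_diff_xstar: "x \<in> X \<Longrightarrow> f x - f xstar = ereal (F x - F xstar)"
  using f_eq_ereal[of x] f_eq_ereal[OF xstar_in_dom] by (metis ereal_minus(1))

lemma grad_xstar: "grad f xstar = 0"
proof -
  have "(\<lambda>h. h \<bullet> grad f xstar) = (\<lambda>h. 0)"
    using has_derivative_F[OF xstar_in_dom] F_xstar_le xstar_in_dom open_dom
    by (intro differential_zero_maxmin[of xstar X F]) auto
  then show ?thesis
    by (metis inner_eq_zero_iff)
qed

text \<open>Cocoercivity of \<open>x\<close> against the minimizer, where the gradient vanishes.
  This is what turns a small function value into a restriction on the gradient norm.\<close>

lemma psi_norm_grad_le:
  assumes "x \<in> X"
  shows "psi l (norm (grad f x)) \<le> F x - F xstar"
proof -
  have "(norm (grad f x))\<^sup>2 / (2 * l (4 * norm (grad f x))) \<le> F x - F xstar"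
    using F_cocoercive[OF assms xstar_in_dom, of "4 * norm (grad f x)" "l (4 * norm (grad f x))"]
    by (simp add: grad_xstar)
  then show ?thesis
    by (simp add: psi_def)
qed

text \<open>Cocoercivity is used with the roles exchanged, based at the minimizer: this only involves \<open>l\<close> at
  \<open>norm (grad f x)\<close> instead of twice this value, as the step size rule requires.\<close>

lemma gradient_step_dist_le:
  assumes x: "x \<in> X" and c: "0 \<le> c" "c \<le> 1 / l (norm (grad f x))"
  shows "norm (x - c *\<^sub>R grad f x - xstar) \<le> norm (x - xstar)"
proof -
  define g where "g = grad f x"
  define L where "L = l (norm g)"
  have "0 < L"
    by (simp add: L_def l_pos)
  have "F x + (xstar - x) \<bullet> g + (norm g)\<^sup>2 / (2 * L) \<le> F xstar"
    using F_cocoercive[OF xstar_in_dom x, of "norm g" L]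
    by (simp add: grad_xstar g_def L_def)
  then have "(1 / L) * (norm g)\<^sup>2 \<le> 2 * ((x - xstar) \<bullet> g)"
    using F_xstar_le[OF x] by (simp add: inner_diff_left)
  moreover have "c * (norm g)\<^sup>2 \<le> (1 / L) * (norm g)\<^sup>2"
    using c by (intro mult_right_mono) (auto simp: L_def g_def)
  ultimately have "c * (c * (norm g)\<^sup>2) \<le> c * (2 * ((x - xstar) \<bullet> g))"
    using c by (intro mult_left_mono) auto
  moreover have "(norm (x - c *\<^sub>R g - xstar))\<^sup>2
      = (norm (x - xstar))\<^sup>2 - c * (2 * ((x - xstar) \<bullet> g)) + c * (c * (norm g)\<^sup>2)"
    by (simp add: power2_norm_eq_inner inner_simps inner_commute algebra_simps)
  ultimately have "(norm (x - c *\<^sub>R g - xstar))\<^sup>2 \<le> (norm (x - xstar))\<^sup>2"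
    by linarith
  then show ?thesis
    by (simp add: g_def)
qed

text \<open>Keeps the output of phase 1 close enough to the minimizer for the gradient bound
  \<open>M\<close> to apply there.\<close>

lemma gd_iter_dist_le:
  assumes "\<forall>i<j. gd_iter f l x0 i \<in> X"
  shows "norm (gd_iter f l x0 j - xstar) \<le> norm (x0 - xstar)"
  using assms
proof (induction j)
  case (Suc j)
  let ?x = "gd_iter f l x0 j"
  have "norm (gd_iter f l x0 (Suc j) - xstar) \<le> norm (?x - xstar)"
    using Suc.prems smooth
    by (simp add: Let_def) (intro gradient_step_dist_le gd_step_size_bounds; simp add: ell_smooth_def)
  then show ?case
    using Suc by simp
qed simp

text \<open>The point is a convex combination of \<open>u\<close> and the gradient step
  \<open>y - c *\<^sub>R grad f y\<close>. The latter lies in the open domain because the step is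
  short, and its weight \<open>1 / (1 + a)\<close> is positive, which puts the combination into the
  interior.\<close>

lemma agd_point_in_dom:
  assumes y: "y \<in> X" and u: "u \<in> closure X" and a: "0 \<le> a"
    and c: "0 \<le> c" "c * L \<le> 1" and L: "l (2 * norm (grad f y)) \<le> L"
  shows "(1 / (1 + a)) *\<^sub>R y + (a / (1 + a)) *\<^sub>R u - (c / (1 + a)) *\<^sub>R grad f y \<in> X"
proof -
  let ?g = "grad f y"
  have "c * L * norm ?g \<le> 1 * norm ?g"
    using c by (intro mult_right_mono) auto
  then have "y + 1 *\<^sub>R (- c *\<^sub>R ?g) \<in> X"
    using c y L by (intro grad_along_short_step[of y "2 * norm ?g" L, THEN conjunct1]) (auto simp: mult_ac)
  then have "y - c *\<^sub>R ?g \<in> X" by simp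
  then have "u - (1 / (1 + a)) *\<^sub>R (u - (y - c *\<^sub>R ?g)) \<in> interior X"
    using a u convex_dom open_dom
    by (intro mem_interior_closure_convex_shrink) (auto simp: interior_open)
  moreover have "u - (1 / (1 + a)) *\<^sub>R (u - (y - c *\<^sub>R ?g))
      = (1 / (1 + a)) *\<^sub>R y + (a / (1 + a)) *\<^sub>R u - (c / (1 + a)) *\<^sub>R ?g"
  proof -
    have "u = (1 / (1 + a)) *\<^sub>R u + (a / (1 + a)) *\<^sub>R u"
      using a by (simp add: scaleR_left_distrib[symmetric] add_divide_distrib[symmetric])
    then show ?thesis
      by (simp add: scaleR_diff_right algebra_simps)
  qed
  ultimately show ?thesis
    using open_dom by (simp add: interior_open)
qed

text \<open>The Lyapunov inequality for an arbitrary coupling parameter \<open>a\<close>; the step size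
  \<open>a\<^sup>2 / \<Gamma>\<close> makes the two quadratic terms in the new gradient cancel.\<close>

lemma agd_lyapunov:
  assumes y: "y \<in> X" and y': "y' \<in> X" and a: "0 \<le> a" and G: "0 < \<Gamma>"
    and y'_eq: "y' = (1 / (1 + a)) *\<^sub>R y + (a / (1 + a)) *\<^sub>R u - (c / (1 + a)) *\<^sub>R grad f y"
    and c: "c = a\<^sup>2 / \<Gamma>" "c * L \<le> 1"
    and s: "norm (grad f y) + norm (grad f y - grad f y') \<le> s" and L: "l s \<le> L"
  shows "(1 + a) * (F y' - F xstar) + \<Gamma> / 2 * (norm (u - (a / \<Gamma>) *\<^sub>R grad f y' - xstar))\<^sup>2
    \<le> F y - F xstar + \<Gamma> / 2 * (norm (u - xstar))\<^sup>2"
proof -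
  define g where "g = grad f y"
  define g' where "g' = grad f y'"
  have "0 \<le> s"
    using s by (meson add_nonneg_nonneg norm_ge_zero order_trans)
  then have "0 < L"
    using l_pos[of s] L by linarith
  \<comment> \<open>The three facts combined at the end are cocoercivity between the two iterates,
    the tangent at \<open>y'\<close> evaluated at the minimizer with weight \<open>a\<close>, and
    the coupling identity tested against \<open>g'\<close>.\<close>
  have "F y' + (y - y') \<bullet> g' + (norm (g - g'))\<^sup>2 / (2 * L) \<le> F y"
    using F_cocoercive[OF y y' s L] by (simp add: g_def g'_def)
  moreover have "c / 2 * (norm (g - g'))\<^sup>2 \<le> 1 / (2 * L) * (norm (g - g'))\<^sup>2"
    using c(2) \<open>0 < L\<close> by (intro mult_right_mono) (auto simp: field_simps)
  ultimately have 1: "F y' + (y - y') \<bullet> g' + c / 2 * (norm (g - g'))\<^sup>2 \<le> F y"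
    by simp
  have 2: "a * (F y' + (xstar - y') \<bullet> g') \<le> a * F xstar"
    using F_above_tangent[OF y' xstar_in_dom] a by (intro mult_left_mono) (auto simp: g'_def)
  have "(1 + a) *\<^sub>R y' = y + a *\<^sub>R u - c *\<^sub>R g"
    using a by (simp add: y'_eq g_def scaleR_diff_right scaleR_add_right)
  then have "((1 + a) *\<^sub>R y') \<bullet> g' = (y + a *\<^sub>R u - c *\<^sub>R g) \<bullet> g'"
    by simp
  then have 3: "y' \<bullet> g' + a * (y' \<bullet> g') = y \<bullet> g' + a * (u \<bullet> g') - c * (g \<bullet> g')"
    by (simp add: inner_simps algebra_simps)
  have "\<Gamma> / 2 * (norm (u - (a / \<Gamma>) *\<^sub>R g' - xstar))\<^sup>2
      = \<Gamma> / 2 * (norm (u - xstar))\<^sup>2 - a * ((u - xstar) \<bullet> g') + c / 2 * (norm g')\<^sup>2"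
  proof -
    have "(norm (w - b *\<^sub>R g'))\<^sup>2 = (norm w)\<^sup>2 - 2 * b * (w \<bullet> g') + b\<^sup>2 * (norm g')\<^sup>2" for w b
      unfolding power2_norm_eq_inner
      by (simp add: inner_simps inner_commute power2_eq_square algebra_simps)
    moreover have "u - (a / \<Gamma>) *\<^sub>R g' - xstar = (u - xstar) - (a / \<Gamma>) *\<^sub>R g'"
      by simp
    ultimately have "(norm (u - (a / \<Gamma>) *\<^sub>R g' - xstar))\<^sup>2
      = (norm (u - xstar))\<^sup>2 - 2 * (a / \<Gamma>) * ((u - xstar) \<bullet> g') + (a / \<Gamma>)\<^sup>2 * (norm g')\<^sup>2"
      by metis
    then show ?thesis
      using G by (simp add: c(1) power2_eq_square field_simps)
  qed
  moreover have "c / 2 * (norm (g - g'))\<^sup>2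
      = c / 2 * (norm g)\<^sup>2 - c * (g \<bullet> g') + c / 2 * (norm g')\<^sup>2"
    by (simp add: power2_norm_eq_inner inner_simps inner_commute algebra_simps)
  moreover have "0 \<le> c / 2 * (norm g)\<^sup>2"
    using G by (simp add: c(1))
  ultimately show ?thesis
    using 1 2 3 unfolding g'_def[symmetric] by (simp add: inner_simps algebra_simps)
qed

text \<open>As the coupling parameter grows from 0 to \<open>a0\<close>, the gradient norm at the candidate point
  varies continuously from at most \<open>D\<close>, and by the Lyapunov inequality it cannot enter the
  gap above \<open>D\<close>.\<close>

lemma agd_step:
  assumes y: "y \<in> X" and u: "u \<in> closure X" and G: "0 < \<Gamma>" and a0: "0 \<le> a0" "a0\<^sup>2 / \<Gamma> * L \<le> 1"
    and V: "F y - F xstar + \<Gamma> / 2 * (norm (u - xstar))\<^sup>2 \<le> \<delta>"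
    and D: "0 < D" "l (4 * D) \<le> L" "norm (grad f y) \<le> D"
    and gap: "D < E" "\<forall>r\<in>{D<..<E}. \<delta> < psi l r"
    and y'_eq: "y' = (1 / (1 + a0)) *\<^sub>R y + (a0 / (1 + a0)) *\<^sub>R u
                - (a0\<^sup>2 / \<Gamma> / (1 + a0)) *\<^sub>R grad f y"
  shows "y' \<in> X" "norm (grad f y') \<le> D"
    "(1 + a0) * (F y' - F xstar) + \<Gamma> / 2 * (norm (u - (a0 / \<Gamma>) *\<^sub>R grad f y' - xstar))\<^sup>2
    \<le> F y - F xstar + \<Gamma> / 2 * (norm (u - xstar))\<^sup>2"
proof -
  define p where "p a = (1 / (1 + a)) *\<^sub>R y + (a / (1 + a)) *\<^sub>R u
                - (a\<^sup>2 / \<Gamma> / (1 + a)) *\<^sub>R grad f y" for a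
  have "0 < L"
    using l_pos[of "4 * D"] D by linarith
  have step_le: "a\<^sup>2 / \<Gamma> * L \<le> 1" if "a \<in> {0..a0}" for a
  proof -
    have "a\<^sup>2 / \<Gamma> * L \<le> a0\<^sup>2 / \<Gamma> * L"
      using that G \<open>0 < L\<close> by (intro mult_right_mono divide_right_mono power_mono) auto
    then show ?thesis using a0 by linarith
  qed
  have p_in: "p a \<in> X" if "a \<in> {0..a0}" for a
  proof -
    have "l (2 * norm (grad f y)) \<le> l (4 * D)"
      using D by (intro l_mono) auto
    then show ?thesis
      unfolding p_def using that y u G D step_le[OF that] by (intro agd_point_in_dom[of _ _ _ _ L]) auto
  qed
  have lyap: "(1 + a) * (F (p a) - F xstar)
      + \<Gamma> / 2 * (norm (u - (a / \<Gamma>) *\<^sub>R grad f (p a) - xstar))\<^sup>2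
      \<le> F y - F xstar + \<Gamma> / 2 * (norm (u - xstar))\<^sup>2"
    if "a \<in> {0..a0}" "norm (grad f (p a)) \<le> 2 * D" for a
  proof (rule agd_lyapunov[OF y p_in[OF that(1)] _ G p_def refl step_le[OF that(1)] _ D(2)])
    \<comment> \<open>The sum is at most \<open>D + (D + 2 * D)\<close>, which accounts for the
      argument \<open>4 * D\<close> of \<open>l\<close>.\<close>
    show "norm (grad f y) + norm (grad f y - grad f (p a)) \<le> 4 * D"
      using D(3) that(2) norm_triangle_ineq4[of "grad f y" "grad f (p a)"] by linarith
  qed (use that in auto)
  have small: "norm (grad f (p a0)) \<le> D"
  proof (rule ccontr)
    assume "\<not> norm (grad f (p a0)) \<le> D"
    \<comment> \<open>\<open>r\<close> is below \<open>E\<close> to lie in the gap, below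
      \<open>2 * D\<close> for the Lyapunov inequality to apply, and below the norm at
      \<open>a0\<close> to be attained on the way.\<close>
    then have "D < min E (min (2 * D) (norm (grad f (p a0))))"
      using gap D by simp
    from dense[OF this] obtain r where r: "D < r" "r < E" "r < 2 * D" "r < norm (grad f (p a0))"
      by auto
    have "continuous_on {0..a0} p"
      unfolding p_def using G by (intro continuous_intros) auto
    then have "continuous_on {0..a0} (\<lambda>a. norm (grad f (p a)))"
      using p_in by (intro continuous_on_norm continuous_on_compose2[OF continuous_on_grad]) auto
    moreover have "norm (grad f (p 0)) \<le> r"
      using D r by (simp add: p_def)
    ultimately obtain a where a: "0 \<le> a" "a \<le> a0" "norm (grad f (p a)) = r"
      using IVT'[of "\<lambda>a. norm (grad f (p a))" 0 r a0] r a0 by auto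
    have "(1 + a) * (F (p a) - F xstar) + \<Gamma> / 2 * (norm (u - (a / \<Gamma>) *\<^sub>R grad f (p a) - xstar))\<^sup>2 \<le> \<delta>"
      using lyap[of a] a r V by simp
    moreover have "0 \<le> \<Gamma> / 2 * (norm (u - (a / \<Gamma>) *\<^sub>R grad f (p a) - xstar))\<^sup>2"
      using G by simp
    moreover have "1 * (F (p a) - F xstar) \<le> (1 + a) * (F (p a) - F xstar)"
      using F_xstar_le[OF p_in[of a]] a by (intro mult_right_mono) auto
    ultimately have "psi l r \<le> \<delta>"
      using psi_norm_grad_le[OF p_in[of a]] a by simp
    then show False
      using bspec[OF gap(2), of r] r by simp
  qed
  have y'_p: "y' = p a0"
    by (simp add: y'_eq p_def)
  show "y' \<in> X" "norm (grad f y') \<le> D"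
    "(1 + a0) * (F y' - F xstar) + \<Gamma> / 2 * (norm (u - (a0 / \<Gamma>) *\<^sub>R grad f y' - xstar))\<^sup>2
    \<le> F y - F xstar + \<Gamma> / 2 * (norm (u - xstar))\<^sup>2"
    unfolding y'_p using p_in[of a0] small lyap[of a0] a0 D by auto
qed

text \<open>Each step contracts the potential by \<open>1 / (1 + a)\<close>, exactly the factor
  applied to \<open>\<Gamma>\<close>, so the bound \<open>\<Gamma> * R\<^sup>2\<close> persists.
  Initially it equals \<open>\<delta>\<close>, half of it covering the function value and half the
  distance term; since \<open>\<Gamma>\<close> decreases, the potential stays within the
  \<open>\<delta>\<close> that the step lemma requires.\<close>

lemma agd_invariant:
  assumes xbar: "xbar \<in> X" "norm (xbar - xstar) \<le> R" "F xbar - F xstar \<le> \<delta> / 2"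
    and pos: "0 < \<delta>" "0 < R"
    and D: "0 < D" "l (4 * D) \<le> 2 * l 0" "norm (grad f xbar) \<le> D"
    and gap: "D < E" "\<forall>r\<in>{D<..<E}. \<delta> < psi l r"
    and st: "agd_state f l \<delta> R xbar k = (y, u, \<Gamma>)"
  shows "y \<in> X \<and> u \<in> closure X \<and> 0 < \<Gamma> \<and> \<Gamma> \<le> \<delta> / R\<^sup>2 \<and> norm (grad f y) \<le> D \<and>
    F y - F xstar + \<Gamma> / 2 * (norm (u - xstar))\<^sup>2 \<le> \<Gamma> * R\<^sup>2"
  using st
proof (induction k arbitrary: y u \<Gamma>)
  case 0
  then have [simp]: "y = xbar" "u = xbar" "\<Gamma> = \<delta> / R\<^sup>2" by auto
  have "\<Gamma> / 2 * (norm (u - xstar))\<^sup>2 \<le> \<Gamma> / 2 * R\<^sup>2"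
    using xbar pos by (intro mult_left_mono power_mono) auto
  then show ?case
    using xbar pos D closure_subset[of X] by auto
next
  case (Suc k)
  obtain y0 u0 \<Gamma>0 where st0: "agd_state f l \<delta> R xbar k = (y0, u0, \<Gamma>0)"
    by (metis prod_cases3)
  define a where "a = sqrt (1 / (2 * l 0) * \<Gamma>0)"
  have IH: "y0 \<in> X" "u0 \<in> closure X" "0 < \<Gamma>0" "\<Gamma>0 \<le> \<delta> / R\<^sup>2" "norm (grad f y0) \<le> D"
    "F y0 - F xstar + \<Gamma>0 / 2 * (norm (u0 - xstar))\<^sup>2 \<le> \<Gamma>0 * R\<^sup>2"
    using Suc.IH[OF st0] by auto
  have "0 < l 0" by (simp add: l_pos)
  have a: "0 \<le> a" "a\<^sup>2 / \<Gamma>0 = 1 / (2 * l 0)"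
    using IH(3) \<open>0 < l 0\<close> by (auto simp: a_def real_sqrt_pow2)
  have new: "y = (1 / (1 + a)) *\<^sub>R y0 + (a / (1 + a)) *\<^sub>R u0 - (1 / (2 * l 0) / (1 + a)) *\<^sub>R grad f y0"
    "u = closest_point (closure X) (u0 - (a / \<Gamma>0) *\<^sub>R grad f y)" "\<Gamma> = \<Gamma>0 / (1 + a)"
    using Suc.prems unfolding a_def by (auto simp: st0 Let_def)
  have "\<Gamma>0 * R\<^sup>2 \<le> \<delta>"
    using IH(4) pos by (simp add: field_simps)
  then have V0: "F y0 - F xstar + \<Gamma>0 / 2 * (norm (u0 - xstar))\<^sup>2 \<le> \<delta>"
    using IH(6) by linarith
  have "a\<^sup>2 / \<Gamma>0 * (2 * l 0) \<le> 1"
    unfolding a(2) using \<open>0 < l 0\<close> by simp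
  note step = agd_step[OF IH(1,2,3) a(1) this V0 D(1,2) IH(5) gap new(1)[folded a(2)]]
  have cl: "closed (closure X)" "closure X \<noteq> {}" "convex (closure X)"
    using dom_nonempty convex_dom by (auto intro: convex_closure)
  \<comment> \<open>Projection onto the closure is nonexpansive and fixes the minimizer, so it does
    not increase the potential.\<close>
  have "xstar \<in> closure X"
    using xstar_in_dom closure_subset by auto
  then have "norm (u - xstar) \<le> norm (u0 - (a / \<Gamma>0) *\<^sub>R grad f y - xstar)"
    using closest_point_lipschitz[OF cl(3,1,2), of "u0 - (a / \<Gamma>0) *\<^sub>R grad f y" xstar]
    by (simp add: new(2) closest_point_self dist_norm)
  then have "\<Gamma>0 / 2 * (norm (u - xstar))\<^sup>2
      \<le> \<Gamma>0 / 2 * (norm (u0 - (a / \<Gamma>0) *\<^sub>R grad f y - xstar))\<^sup>2"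
    using IH(3) by (intro mult_left_mono power_mono) auto
  then have "(1 + a) * (F y - F xstar) + \<Gamma>0 / 2 * (norm (u - xstar))\<^sup>2 \<le> \<Gamma>0 * R\<^sup>2"
    using step(3) IH(6) by linarith
  moreover have "\<Gamma>0 = (1 + a) * \<Gamma>"
    using a(1) by (simp add: new(3))
  ultimately have "(1 + a) * (F y - F xstar + \<Gamma> / 2 * (norm (u - xstar))\<^sup>2) \<le> (1 + a) * (\<Gamma> * R\<^sup>2)"
    by (simp add: algebra_simps)
  then have "F y - F xstar + \<Gamma> / 2 * (norm (u - xstar))\<^sup>2 \<le> \<Gamma> * R\<^sup>2"
    using a(1) by (simp add: mult_le_cancel_left)
  moreover have "\<Gamma> \<le> \<Gamma>0"
    using a(1) IH(3) by (simp add: new(3) field_simps)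
  ultimately show ?case
    using step(1,2) closest_point_in_set[OF cl(1,2)] IH(3,4) a(1) by (auto simp: new(2,3))
qed

end

section \<open>Decay of the potential\<close>

text \<open>For positive \<open>B\<close>, the \<open>K\<close> steps split into a first stretch,
  counted by the logarithm, until some \<open>a k \<le> 2\<close>, and at least \<open>B\<close>
  further steps that each raise \<open>1 / a\<close> by at least \<open>1 / 3\<close>.\<close>

lemma agd_coupling_decay:
  fixes a :: "nat \<Rightarrow> real"
  assumes rec: "\<And>k. a (Suc k) = a k / sqrt (1 + a k)" and a0: "0 < a 0"
    and K: "B + max (1 + log (3 / 2) (a 0 / 2)) 0 \<le> real K"
  shows "0 < a K" "B / 3 \<le> 1 / a K"
proof -
  have pos: "0 < a k" for k
    by (induction k) (auto simp: rec a0)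
  have small: "a (k + n) \<le> 2 \<and> real n / 3 \<le> 1 / a (k + n)" if "a k \<le> 2" for k n
  proof (induction n)
    case 0
    then show ?case
      using that pos[of k] by simp
  next
    case (Suc n)
    define b where "b = a (k + n)"
    have b: "0 < b" "b \<le> 2" "real n / 3 \<le> 1 / b"
      using Suc pos by (auto simp: b_def)
    \<comment> \<open>This is equivalent to \<open>1 + b / 3 \<le> sqrt (1 + b)\<close>, from which
      the gain of \<open>1 / 3\<close> in \<open>1 / b\<close> follows.\<close>
    have "b * b \<le> 3 * b"
      using b by (intro mult_right_mono) auto
    then have "(1 + b / 3)\<^sup>2 \<le> 1 + b"
      by (simp add: power2_eq_square algebra_simps)
    then have sq: "1 + b / 3 \<le> sqrt (1 + b)"
      by (rule real_le_rsqrt)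
    have "b / sqrt (1 + b) \<le> b / 1"
      using b by (intro divide_left_mono) auto
    moreover have "1 / b + 1 / 3 = (1 + b / 3) / b"
      using b by (simp add: field_simps)
    moreover have "(1 + b / 3) / b \<le> sqrt (1 + b) / b"
      using b sq by (intro divide_right_mono) auto
    ultimately show ?case
      using b by (simp add: rec b_def[symmetric] add_divide_distrib)
  qed
  obtain k where k: "a k \<le> 2" "real k \<le> max (1 + log (3 / 2) (a 0 / 2)) 0"
  proof (cases "a 0 \<le> 2")
    case True
    then show ?thesis
      using that[of 0] by simp
  next
    case False
    define m where "m = nat \<lceil>log (3 / 2) (a 0 / 2)\<rceil>"
    have "0 < log (3 / 2) (a 0 / 2)"
      using False by simp
    then have m: "log (3 / 2) (a 0 / 2) \<le> real m" "real m \<le> 1 + log (3 / 2) (a 0 / 2)"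
      unfolding m_def by linarith+
    have "\<exists>j\<le>m. a j \<le> 2"
    proof (rule ccontr)
      assume "\<not> (\<exists>j\<le>m. a j \<le> 2)"
      then have large: "2 < a j" if "j \<le> m" for j
        using that by force
      have "a j \<le> a 0 / (3 / 2) ^ j" if "j \<le> m" for j
        using that
      proof (induction j)
        case (Suc j)
        \<comment> \<open>Above 2 the square root exceeds \<open>sqrt 3\<close>, which is more than
          \<open>3 / 2\<close>: hence the base of the logarithm.\<close>
        have "3 / 2 \<le> sqrt (1 + a j)"
          using large[of j] Suc.prems by (intro real_le_rsqrt) (auto simp: power2_eq_square)
        then have "a (Suc j) \<le> a j / (3 / 2)"
          unfolding rec using pos[of j] by (intro divide_left_mono) auto
        also have "\<dots> \<le> a 0 / (3 / 2) ^ j / (3 / 2)"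
          using Suc by (intro divide_right_mono) auto
        finally show ?case by (simp add: field_simps)
      qed simp
      from this[of m] have "a m \<le> a 0 / (3 / 2) ^ m" by simp
      moreover have "a 0 / 2 \<le> (3 / 2) ^ m"
        using m(1) a0 by (simp add: log_le_iff powr_realpow)
      then have "a 0 / (3 / 2) ^ m \<le> 2"
        by (simp add: field_simps)
      ultimately show False
        using large[of m] by simp
    qed
    then obtain j where "j \<le> m" "a j \<le> 2" by blast
    then show ?thesis
      using that[of j] m(2) by simp
  qed
  show "0 < a K" by (rule pos)
  \<comment> \<open>For \<open>B \<le> 0\<close> the index \<open>k\<close> may exceed
    \<open>K\<close>, but then positivity of \<open>a K\<close> suffices.\<close>
  show "B / 3 \<le> 1 / a K"
  proof (cases "B \<le> 0")
    case True
    then have "B / 3 \<le> 0" by simp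
    also have "0 \<le> 1 / a K"
      using pos[of K] by simp
    finally show ?thesis .
  next
    case False
    then have "k \<le> K" "B \<le> real (K - k)"
      using k(2) K by auto
    then show ?thesis
      using small[OF k(1), of "K - k"] by auto
  qed
qed

lemma Lyapunov_weight_bound:
  fixes \<Gamma> :: "nat \<Rightarrow> real"
  assumes pos: "0 < c" "0 < \<delta>" "0 < R" "0 < \<epsilon>"
    and \<Gamma>: "\<Gamma> 0 = \<delta> / R\<^sup>2" "\<And>k. \<Gamma> (Suc k) = \<Gamma> k / (1 + sqrt (1 / (2 * c) * \<Gamma> k))"
    and K: "5 * sqrt c * R / sqrt \<epsilon> + max (1 + 1 / 2 * log (3 / 2) (\<delta> / (8 * c * R\<^sup>2))) 0 \<le> real K"
  shows "\<Gamma> K * R\<^sup>2 \<le> \<epsilon>"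
proof -
  define a where "a k = sqrt (1 / (2 * c) * \<Gamma> k)" for k
  define B where "B = 5 * sqrt c * R / sqrt \<epsilon>"
  have "0 < B"
    using pos by (simp add: B_def)
  have rec: "a (Suc k) = a k / sqrt (1 + a k)" for k
    by (simp add: a_def \<Gamma>(2) real_sqrt_divide real_sqrt_mult)
  have "0 < a 0"
    using pos by (simp add: a_def \<Gamma>(1))
  \<comment> \<open>Since \<open>a 0\<close> is the root of
    \<open>\<delta> / (2 * c * R\<^sup>2)\<close>, halving it turns the 2 into 8, and the root gives
    the factor \<open>1 / 2\<close> before the logarithm.\<close>
  have "(a 0 / 2)\<^sup>2 = \<delta> / (8 * c * R\<^sup>2)"
    using pos by (simp add: a_def \<Gamma>(1) power_divide field_simps)
  then have "1 / 2 * log (3 / 2) (\<delta> / (8 * c * R\<^sup>2)) = log (3 / 2) (a 0 / 2)"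
    using \<open>0 < a 0\<close> log_nat_power[of "a 0 / 2" "3 / 2" 2] by simp
  then have a: "0 < a K" "B / 3 \<le> 1 / a K"
    using agd_coupling_decay[OF rec \<open>0 < a 0\<close>, of B K] K by (simp_all add: B_def)
  have "B * a K \<le> 3"
    using a by (simp add: field_simps)
  then have "(B * a K)\<^sup>2 \<le> 3\<^sup>2"
    using a \<open>0 < B\<close> by (intro power_mono) auto
  moreover have "(a K)\<^sup>2 = \<Gamma> K / (2 * c)"
  proof -
    \<comment> \<open>\<open>sqrt\<close> is negative at negative arguments, so
      \<open>0 < a K\<close> yields the sign of \<open>\<Gamma> K\<close>.\<close>
    have "0 < 1 / (2 * c) * \<Gamma> K"
      using a(1) unfolding a_def real_sqrt_gt_0_iff .
    then show ?thesis
      by (simp add: a_def)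
  qed
  moreover have "B\<^sup>2 = 25 * c * R\<^sup>2 / \<epsilon>"
    using pos by (simp add: B_def power_mult_distrib power_divide)
  \<comment> \<open>The constant 5 enters as \<open>25 \<ge> 2 * 3\<^sup>2\<close>, with 3 from
    \<open>B * a K \<le> 3\<close> and 2 from
    \<open>\<Gamma> K = 2 * c * (a K)\<^sup>2\<close>.\<close>
  ultimately have "25 * (\<Gamma> K * R\<^sup>2) \<le> 18 * \<epsilon>"
    using pos by (simp add: power_mult_distrib field_simps)
  then show ?thesis
    using pos by simp
qed

section \<open>The function \<open>psi\<close> and the admissible set\<close>

locale smoothness_function =
  fixes l :: "real \<Rightarrow> real"
  assumes mono: "mono_on {0..} l" and pos: "\<And>s. 0 \<le> s \<Longrightarrow> 0 < l s"
    and lipschitz: "locally_lipschitz_on {0..} l"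
begin

lemma continuous_on_l: "continuous_on {0..} l"
  unfolding continuous_on_eq_continuous_within
proof
  fix s :: real assume s: "s \<in> {0..}"
  then obtain r L where r: "r > 0" "L-lipschitz_on (cball s r \<inter> {0..}) l"
    using lipschitz unfolding locally_lipschitz_on_def by blast
  then have "continuous (at s within cball s r \<inter> {0..}) l"
    using lipschitz_on_continuous_on s r(1) by (fastforce simp: continuous_on_eq_continuous_within)
  moreover have "at s within cball s r \<inter> {0..} = at s within {0..}"
    using r(1) by (intro at_within_nhd[of s "ball s r"]) auto
  ultimately show "continuous (at s within {0..}) l" by simp
qed

lemma continuous_on_psi: "continuous_on {0..} (psi l)"
proof -
  have "continuous_on {0..} (\<lambda>x. l (4 * x))"
    by (intro continuous_on_compose2[OF continuous_on_l] continuous_intros) auto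
  then show ?thesis
    unfolding psi_def using pos by (intro continuous_intros) (auto simp: less_imp_neq[symmetric])
qed

section \<open>Values and growth of \<open>psi\<close>, and its turning point\<close>

lemma psi_0 [simp]: "psi l 0 = 0"
  by (simp add: psi_def)

lemma psi_pos: "0 < x \<Longrightarrow> 0 < psi l x"
  using pos[of "4 * x"] by (simp add: psi_def)

lemma psi_IVT:
  assumes "0 \<le> a" "a \<le> b" "psi l a \<le> y \<and> y \<le> psi l b \<or> psi l b \<le> y \<and> y \<le> psi l a"
  obtains x where "a \<le> x" "x \<le> b" "psi l x = y"
proof -
  have "continuous_on {a..b} (psi l)"
    using continuous_on_psi by (rule continuous_on_subset) (use assms in auto)
  then show ?thesis
    using that assms IVT'[of "psi l" a y b] IVT2'[of "psi l" b y a] by blast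
qed

text \<open>Makes \<open>Delta_max\<close> positive. Near 0 the increments of \<open>l\<close> are
  controlled by the Lipschitz constant while \<open>l\<close> stays at least \<open>l 0\<close>, so
  the growth of the square in the numerator dominates.\<close>

lemma psi_strict_mono_near_0: "\<exists>d>0. strict_mono_on {x. 0 \<le> x \<and> ereal x < ereal d} (psi l)"
proof -
  obtain r L where r: "r > 0" "L-lipschitz_on (cball 0 r \<inter> {0..}) l"
    using lipschitz unfolding locally_lipschitz_on_def by (metis atLeast_iff order_refl)
  then have "0 \<le> L"
    by (simp add: lipschitz_on_def)
  have "0 < l 0" by (simp add: pos)
  \<comment> \<open>\<open>r / 4\<close> keeps \<open>4 * x\<close> and \<open>4 * y\<close> in the
    Lipschitz ball; the other bound makes \<open>4 * L * x \<le> l 0\<close>, with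
    \<open>+ 1\<close> guarding against \<open>L = 0\<close>.\<close>
  define d where "d = min (r / 4) (l 0 / (4 * L + 1))"
  have "0 < d"
    using r \<open>0 < l 0\<close> \<open>0 \<le> L\<close> by (simp add: d_def)
  moreover have "strict_mono_on {x. 0 \<le> x \<and> ereal x < ereal d} (psi l)"
  proof (rule strict_mono_onI)
    fix x y assume xy: "x \<in> {x. 0 \<le> x \<and> ereal x < ereal d}" "y \<in> {x. 0 \<le> x \<and> ereal x < ereal d}" "x < y"
    then have x: "0 \<le> x" "x < d" and y: "0 < y" "y < d" by auto
    have "l 0 \<le> l (4 * x)" and pos_xy: "0 < l (4 * x)" "0 < l (4 * y)"
      using x y pos mono_onD[OF mono, of 0 "4 * x"] by auto
    have "dist (l (4 * y)) (l (4 * x)) \<le> L * dist (4 * y) (4 * x)"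
      using x y by (intro lipschitz_onD[OF r(2)]) (auto simp: d_def dist_real_def)
    then have "l (4 * y) \<le> l (4 * x) + 4 * L * (y - x)"
      using xy by (simp add: dist_real_def abs_le_iff algebra_simps)
    then have "x\<^sup>2 * l (4 * y) \<le> x\<^sup>2 * (l (4 * x) + 4 * L * (y - x))"
      by (intro mult_left_mono) auto
    also have "\<dots> = x\<^sup>2 * l (4 * x) + (y - x) * (x * (4 * L * x))"
      by (simp add: power2_eq_square algebra_simps)
    also have "(y - x) * (x * (4 * L * x)) < (y - x) * ((x + y) * l (4 * x))"
    proof (rule mult_strict_left_mono)
      have "4 * L * x \<le> 4 * L * d"
        using x \<open>0 \<le> L\<close> by (intro mult_left_mono) auto
      also have "\<dots> \<le> (4 * L + 1) * d"
        using \<open>0 < d\<close> by (simp add: algebra_simps)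
      also have "\<dots> \<le> (4 * L + 1) * (l 0 / (4 * L + 1))"
        using \<open>0 \<le> L\<close> by (intro mult_left_mono) (auto simp: d_def)
      also have "\<dots> = l 0"
        using \<open>0 \<le> L\<close> by (simp add: field_simps)
      also have "\<dots> \<le> l (4 * x)" by fact
      finally have "x * (4 * L * x) \<le> x * l (4 * x)"
        using x by (intro mult_left_mono) auto
      also have "\<dots> < (x + y) * l (4 * x)"
        using y pos_xy by simp
      finally show "x * (4 * L * x) < (x + y) * l (4 * x)" .
    qed (use xy in auto)
    finally have "x\<^sup>2 * l (4 * y) < y\<^sup>2 * l (4 * x)"
      by (simp add: power2_eq_square algebra_simps)
    then show "psi l x < psi l y"
      using pos_xy by (simp add: psi_def field_simps)
  qed
  ultimately show ?thesis by blast
qed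

text \<open>\<open>GREATEST\<close> is meaningful only once a greatest element is exhibited: the
  supremum is admissible because two points below it lie below a common admissible
  \<open>D\<close>.\<close>

lemma Delta_max_props:
  "0 < Delta_max l" "strict_mono_on {x. 0 \<le> x \<and> ereal x < Delta_max l} (psi l)"
proof -
  define P where "P D \<longleftrightarrow> 0 < D \<and> strict_mono_on {x. 0 \<le> x \<and> ereal x < D} (psi l)" for D :: ereal
  obtain d where d: "0 < d" "P (ereal d)"
    using psi_strict_mono_near_0 by (auto simp: P_def)
  have "P (Sup (Collect P))"
  proof (rule P_def[THEN iffD2, OF conjI])
    have "0 < ereal d"
      using d(1) by simp
    also have "\<dots> \<le> Sup (Collect P)"
      using d(2) by (intro Sup_upper) auto
    finally show "0 < Sup (Collect P)" .
    show "strict_mono_on {x. 0 \<le> x \<and> ereal x < Sup (Collect P)} (psi l)"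
    proof (rule strict_mono_onI)
      fix x y assume xy: "x \<in> {x. 0 \<le> x \<and> ereal x < Sup (Collect P)}"
        "y \<in> {x. 0 \<le> x \<and> ereal x < Sup (Collect P)}" "x < y"
      then obtain D where "P D" "ereal y < D"
        by (auto simp: less_Sup_iff)
      moreover have "ereal x < D"
        using \<open>x < y\<close> \<open>ereal y < D\<close> by (meson ereal_less_eq(3) less_imp_le le_less_trans)
      ultimately show "psi l x < psi l y"
        using xy strict_mono_onD[of "{x. 0 \<le> x \<and> ereal x < D}" "psi l" x y]
        by (simp add: P_def)
    qed
  qed
  then have "Greatest P = Sup (Collect P)"
    by (rule Greatest_equality) (simp add: Sup_upper)
  then have "P (Delta_max l)"
    using \<open>P (Sup _)\<close> by (simp add: Delta_max_def P_def[abs_def])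
  then show "0 < Delta_max l" "strict_mono_on {x. 0 \<le> x \<and> ereal x < Delta_max l} (psi l)"
    by (auto simp: P_def)
qed

lemma psi_strict_mono: "0 \<le> x \<Longrightarrow> x < y \<Longrightarrow> ereal y < Delta_max l \<Longrightarrow> psi l x < psi l y"
  using order.strict_trans[of "ereal x" "ereal y" "Delta_max l"]
  by (auto intro!: strict_mono_onD[OF Delta_max_props(2)])

lemma psi_Delta_max_infinite:
  assumes "Delta_max l = \<infinity>"
  shows "psi_Delta_max l = (SUP x\<in>{0..}. ereal (psi l x))" (is "_ = ?S")
proof -
  have "((\<lambda>x. ereal (psi l x)) \<longlongrightarrow> ?S) at_top"
  proof (rule order_tendstoI)
    fix c assume "c < ?S"
    then obtain x where x: "0 \<le> x" "c < ereal (psi l x)"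
      by (auto simp: less_SUP_iff)
    have "c < ereal (psi l y)" if "x \<le> y" for y
    proof (cases "x = y")
      case False
      then have "psi l x < psi l y"
        using that x assms by (intro psi_strict_mono) auto
      then show ?thesis
        using x(2) by (meson ereal_less_eq(3) less_imp_le less_le_trans)
    qed (use x in auto)
    then show "eventually (\<lambda>x. c < ereal (psi l x)) at_top"
      unfolding eventually_at_top_linorder by blast
  next
    fix c assume "?S < c"
    have "ereal (psi l x) < c" if "0 \<le> x" for x
      using that by (intro le_less_trans[OF SUP_upper \<open>?S < c\<close>]) auto
    then show "eventually (\<lambda>x. ereal (psi l x) < c) at_top"
      unfolding eventually_at_top_linorder by blast
  qed
  then show ?thesis
    using assms by (simp add: psi_Delta_max_def tendsto_Lim)
qed

lemma psi_Delta_max_pos: "0 < psi_Delta_max l"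
proof (cases "Delta_max l")
  case (real m)
  then show ?thesis
    using Delta_max_props(1) psi_pos[of m] by (simp add: psi_Delta_max_def)
next
  case PInf
  have "0 < ereal (psi l 1)"
    using psi_pos[of 1] by simp
  also have "\<dots> \<le> (SUP x\<in>{0..}. ereal (psi l x))"
    by (rule SUP_upper) simp
  finally show ?thesis
    using psi_Delta_max_infinite[OF PInf] by simp
next
  case MInf
  then show ?thesis
    using Delta_max_props(1) by simp
qed

text \<open>A positive finite \<open>psi_Delta_max l\<close> exceeds its half; an infinite one
  exceeds every real \<open>\<delta>\<close>.\<close>

lemma less_psi_Delta_max:
  assumes "ereal \<delta> \<le> psi_Delta_max l / 2"
  shows "ereal \<delta> < psi_Delta_max l"
  using assms psi_Delta_max_pos by (cases "psi_Delta_max l") auto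

lemma Delta_left_props:
  assumes "0 \<le> \<delta>" "ereal \<delta> \<le> psi_Delta_max l / 2"
  shows "0 \<le> Delta_left l \<delta>" "ereal (Delta_left l \<delta>) < Delta_max l" "psi l (Delta_left l \<delta>) = \<delta>"
proof -
  note less = less_psi_Delta_max[OF assms(2)]
  have "\<exists>x. 0 \<le> x \<and> ereal x < Delta_max l \<and> psi l x = \<delta>"
  proof (cases "Delta_max l")
    case (real m)
    then have m: "0 < m" "\<delta> < psi l m"
      using less Delta_max_props(1) by (auto simp: psi_Delta_max_def)
    then obtain x where "0 \<le> x" "x \<le> m" "psi l x = \<delta>"
      using psi_IVT[of 0 m \<delta>] assms by auto
    moreover have "x \<noteq> m"
      using m \<open>psi l x = \<delta>\<close> by auto
    ultimately show ?thesis
      using real by auto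
  next
    case PInf
    obtain b where "0 \<le> b" "\<delta> < psi l b"
      using less by (auto simp: psi_Delta_max_infinite[OF PInf] less_SUP_iff)
    then obtain x where "0 \<le> x" "psi l x = \<delta>"
      using psi_IVT[of 0 b \<delta>] assms by auto
    then show ?thesis
      using PInf by auto
  qed (use Delta_max_props(1) in auto)
  then have "\<exists>!x. 0 \<le> x \<and> ereal x < Delta_max l \<and> psi l x = \<delta>"
    using psi_strict_mono by (metis less_irrefl linorder_neqE)
  from theI'[OF this]
  show "0 \<le> Delta_left l \<delta>" "ereal (Delta_left l \<delta>) < Delta_max l" "psi l (Delta_left l \<delta>) = \<delta>"
    by (auto simp: Delta_left_def)
qed

text \<open>Eliminates \<open>LEAST\<close>: the solution set is closed by continuity of
  \<open>psi\<close>, so its infimum is attained. An empty set makes both sides true.\<close>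

lemma le_Delta_right_iff:
  "ereal c \<le> Delta_right l \<delta> \<longleftrightarrow> (\<forall>x. Delta_max l \<le> ereal x \<longrightarrow> psi l x = \<delta> \<longrightarrow> c \<le> x)"
proof (cases "\<exists>x. Delta_max l \<le> ereal x \<and> psi l x = \<delta>")
  case True
  define S where "S = {x. Delta_max l \<le> ereal x \<and> psi l x = \<delta>}"
  obtain m where m: "Delta_max l = ereal m" "0 < m"
    using True Delta_max_props(1) by (cases "Delta_max l") auto
  have S_eq: "S = {m..} \<inter> psi l -` {\<delta>}"
    by (auto simp: S_def m)
  have "continuous_on {m..} (psi l)"
    using continuous_on_psi by (rule continuous_on_subset) (use m in auto)
  then have "closed S"
    unfolding S_eq by (intro continuous_closed_preimage) auto
  moreover have bdd: "bdd_below S"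
    by (auto simp: S_eq intro!: bdd_belowI[of _ m])
  ultimately have Inf_S: "Inf S \<in> S"
    using True by (intro closed_contains_Inf) (auto simp: S_def)
  have "(LEAST x. x \<in> S) = Inf S"
    using Inf_S bdd by (intro Least_equality cInf_lower)
  then have "Delta_right l \<delta> = ereal (Inf S)"
    using True by (simp add: Delta_right_def S_def)
  then show ?thesis
    using Inf_S cInf_lower[OF _ bdd] by (force simp: S_def)
qed (auto simp: Delta_right_def)

text \<open>Lowering \<open>\<delta>\<close> lowers \<open>Delta_left\<close> and cannot lower
  \<open>Delta_right\<close>: beyond \<open>Delta_max\<close>, \<open>psi\<close> starts above
  \<open>\<delta>\<close> and must pass \<open>\<delta>\<close> before it comes down to
  \<open>\<delta>'\<close>.\<close>

lemma Q_set_downward: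
  assumes Q: "\<delta> \<in> Q_set l \<Delta> M" and \<delta>': "0 \<le> \<delta>'" "\<delta>' \<le> \<delta>"
  shows "\<delta>' \<in> Q_set l \<Delta> M"
proof -
  have half: "ereal \<delta> \<le> psi_Delta_max l / 2"
    using Q by (simp add: Q_set_def)
  then have half': "ereal \<delta>' \<le> psi_Delta_max l / 2"
    using \<delta>' by (meson ereal_less_eq(3) order_trans)
  have "0 \<le> \<delta>" using \<delta>' by simp
  note left = Delta_left_props[OF \<open>0 \<le> \<delta>\<close> half]
  note left' = Delta_left_props[OF \<delta>'(1) half']
  have "Delta_left l \<delta>' \<le> Delta_left l \<delta>"
    using psi_strict_mono[of "Delta_left l \<delta>" "Delta_left l \<delta>'"] left left' \<delta>' by linarith
  then have "l (4 * Delta_left l \<delta>') \<le> l (4 * Delta_left l \<delta>)"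
    using left' by (intro mono_onD[OF mono]) auto
  moreover have "ereal (2 * M) \<le> Delta_right l \<delta>'"
    unfolding le_Delta_right_iff
  proof (intro allI impI)
    fix x assume x: "Delta_max l \<le> ereal x" "psi l x = \<delta>'"
    then obtain m where m: "Delta_max l = ereal m" "0 < m" "m \<le> x"
      using Delta_max_props(1) by (cases "Delta_max l") auto
    then have "\<delta> < psi l m"
      using less_psi_Delta_max[OF half] by (simp add: psi_Delta_max_def)
    then obtain w where "m \<le> w" "w \<le> x" "psi l w = \<delta>"
      using psi_IVT[of m x \<delta>] m x \<delta>' by auto
    moreover have "\<forall>w. Delta_max l \<le> ereal w \<longrightarrow> psi l w = \<delta> \<longrightarrow> 2 * M \<le> w"
      using Q unfolding le_Delta_right_iff[symmetric] by (simp add: Q_set_def)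
    ultimately show "2 * M \<le> x"
      using m by force
  qed
  ultimately show ?thesis
    using Q \<delta>' half' by (auto simp: Q_set_def)
qed

text \<open>\<open>psi\<close> has no positive zero, so \<open>Delta_right\<close> is infinite at 0.
  This supplies a minimizer when \<open>k_total\<close> is infinite on all of
  \<open>Q_set\<close>.\<close>

lemma zero_in_Q_set:
  assumes "0 \<le> \<Delta>"
  shows "0 \<in> Q_set l \<Delta> M"
proof -
  have half: "ereal 0 \<le> psi_Delta_max l / 2"
    using psi_Delta_max_pos by (cases "psi_Delta_max l") auto
  note left = Delta_left_props[OF order_refl half]
  have "Delta_left l 0 = 0"
    using left psi_pos[of "Delta_left l 0"] by linarith
  moreover have "ereal (2 * M) \<le> Delta_right l 0"
    unfolding le_Delta_right_iff
  proof (intro allI impI)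
    fix x assume "Delta_max l \<le> ereal x" "psi l x = 0"
    then have "0 < ereal x" "psi l x = 0"
      using Delta_max_props(1) by (blast intro: less_le_trans)+
    then show "2 * M \<le> x"
      using psi_pos[of x] by simp
  qed
  ultimately show ?thesis
    using half assms pos[of 0] by (simp add: Q_set_def)
qed

text \<open>Extracts what phase 2 uses: the gap above \<open>D\<close> lies below
  \<open>Delta_max\<close>, where \<open>psi\<close> is increasing, and its upper end
  \<open>E\<close> is real even if \<open>Delta_max\<close> is infinite.\<close>

lemma Q_set_gap:
  assumes Q: "\<delta> \<in> Q_set l \<Delta> M" and "0 < \<delta>"
  obtains D E where "0 < D" "l (4 * D) \<le> 2 * l 0" "D < E"
    "\<forall>r\<in>{D<..<E}. \<delta> < psi l r"
    "\<And>r. 0 \<le> r \<Longrightarrow> r \<le> M \<Longrightarrow> psi l r \<le> \<delta> \<Longrightarrow> r \<le> D"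
proof -
  define D where "D = Delta_left l \<delta>"
  have half: "ereal \<delta> \<le> psi_Delta_max l / 2"
    using Q by (simp add: Q_set_def)
  have D: "0 \<le> D" "ereal D < Delta_max l" "psi l D = \<delta>"
    using Delta_left_props[of \<delta>] \<open>0 < \<delta>\<close> half by (auto simp: D_def)
  have "0 < D"
    using D \<open>0 < \<delta>\<close> by (cases "D = 0") auto
  obtain E where E: "D < E" "ereal E \<le> Delta_max l"
    using D(2) by (metis ereal_dense2 ereal_less_eq(3) less_ereal.simps(1) less_imp_le)
  have above: "\<delta> < psi l r" if "D < r" "ereal r < Delta_max l" for r
    using psi_strict_mono[of D r] that D by simp
  have le_D: "r \<le> D" if r: "0 \<le> r" "r \<le> M" "psi l r \<le> \<delta>" for r
  proof (rule ccontr)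
    assume "\<not> r \<le> D"
    then have "Delta_max l \<le> ereal r"
      using above[of r] r by force
    then obtain m where m: "Delta_max l = ereal m" "0 < m" "m \<le> r"
      using Delta_max_props(1) by (cases "Delta_max l") auto
    then have "\<delta> < psi l m"
      using less_psi_Delta_max[OF half] by (simp add: psi_Delta_max_def)
    then obtain w where "m \<le> w" "w \<le> r" "psi l w = \<delta>"
      using psi_IVT[of m r \<delta>] m r by auto
    moreover have "\<forall>w. Delta_max l \<le> ereal w \<longrightarrow> psi l w = \<delta> \<longrightarrow> 2 * M \<le> w"
      using Q unfolding le_Delta_right_iff[symmetric] by (simp add: Q_set_def)
    \<comment> \<open>Together with \<open>r \<le> M\<close> this forces \<open>r \<le> 0\<close>,
      whereas \<open>r\<close> exceeds \<open>D\<close>.\<close>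
    ultimately have "2 * M \<le> r"
      using m by force
    then show False
      using r \<open>\<not> r \<le> D\<close> \<open>0 < D\<close> by linarith
  qed
  show ?thesis
  proof (rule that[OF \<open>0 < D\<close> _ E(1) _ le_D])
    show "l (4 * D) \<le> 2 * l 0"
      using Q by (simp add: Q_set_def D_def)
    show "\<forall>r\<in>{D<..<E}. \<delta> < psi l r"
      using less_le_trans[OF _ E(2)] by (auto intro: above)
  qed
qed

end

section \<open>Oracle complexity\<close>

context ell_smooth_convex_min
begin

sublocale smoothness_function l
  using smooth by unfold_locales (auto simp: ell_smooth_def)

lemma eps_solutionI:
  assumes "x \<in> X" "F x - F xstar \<le> \<epsilon>"
  shows "eps_solution f \<epsilon> x"
proof -
  have "(INF z. f z) = f xstar"
    using minimum by (intro antisym INF_lower INF_greatest) auto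
  then show ?thesis
    using assms by (simp add: eps_solution_def f_diff_xstar)
qed

text \<open>\<open>M\<close> excludes the range above the gap at the starting point; the invariant
  then keeps the gradient norm below the gap and the iterates in the domain, so that no gradient
  query fails.\<close>

lemma agd_reaches_eps:
  assumes xbar: "xbar \<in> X" "norm (xbar - xstar) \<le> R" "F xbar - F xstar \<le> \<delta> / 2"
    and M: "norm (grad f xbar) \<le> M"
    and pos: "0 < \<delta>" "0 < R" "0 < \<epsilon>"
    and Q: "\<delta> \<in> Q_set l \<Delta> M"
    and K: "5 * sqrt (l 0) * R / sqrt \<epsilon> + max (1 + 1 / 2 * log (3 / 2) (\<delta> / (8 * l 0 * R\<^sup>2))) 0 \<le> real K"
  shows "\<forall>k. agd_iter f l \<delta> R xbar k \<in> X" "eps_solution f \<epsilon> (agd_iter f l \<delta> R xbar K)"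
proof -
  obtain D E where D: "0 < D" "l (4 * D) \<le> 2 * l 0"
    and gap: "D < E" "\<forall>r\<in>{D<..<E}. \<delta> < psi l r"
    and below: "\<And>r. 0 \<le> r \<Longrightarrow> r \<le> M \<Longrightarrow> psi l r \<le> \<delta> \<Longrightarrow> r \<le> D"
    using Q_set_gap[OF Q pos(1)] by blast
  have "norm (grad f xbar) \<le> D"
    using psi_norm_grad_le[OF xbar(1)] xbar(3) pos(1) M by (intro below) auto
  note inv = agd_invariant[OF xbar pos(1,2) D this gap]
  define \<Gamma> where "\<Gamma> k = snd (snd (agd_state f l \<delta> R xbar k))" for k
  have state: "agd_iter f l \<delta> R xbar k \<in> X \<and> F (agd_iter f l \<delta> R xbar k) - F xstar \<le> \<Gamma> k * R\<^sup>2" for k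
  proof -
    obtain y u G where st: "agd_state f l \<delta> R xbar k = (y, u, G)"
      by (metis prod_cases3)
    have "0 \<le> G / 2 * (norm (u - xstar))\<^sup>2"
      using inv[OF st] by simp
    then have "y \<in> X \<and> F y - F xstar \<le> G * R\<^sup>2"
      using inv[OF st] by linarith
    then show ?thesis
      by (simp add: agd_iter_def \<Gamma>_def st)
  qed
  have "\<Gamma> 0 = \<delta> / R\<^sup>2" "\<And>k. \<Gamma> (Suc k) = \<Gamma> k / (1 + sqrt (1 / (2 * l 0) * \<Gamma> k))"
    by (auto simp: \<Gamma>_def Let_def split: prod.split)
  then have "\<Gamma> K * R\<^sup>2 \<le> \<epsilon>"
    using l_pos[of 0] pos K by (intro Lyapunov_weight_bound) auto
  then show "eps_solution f \<epsilon> (agd_iter f l \<delta> R xbar K)"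
    using state[of K] by (intro eps_solutionI) auto
  show "\<forall>k. agd_iter f l \<delta> R xbar k \<in> X"
    using state by blast
qed

lemma k_GD_attained:
  assumes "k_GD f l xstar x0 \<delta> = enat J"
  shows "\<forall>i<J. gd_iter f l x0 i \<in> X" "f (gd_iter f l x0 J) - f xstar \<le> ereal (\<delta> / 2)"
proof -
  define S where "S = {j. (\<forall>i<j. gd_iter f l x0 i \<in> X) \<and>
    f (gd_iter f l x0 j) - f xstar \<le> ereal (\<delta> / 2)}"
  have "Inf (enat ` S) = enat J"
    using assms by (simp add: k_GD_def S_def)
  moreover from this have "enat ` S \<noteq> {}"
    by (auto simp: Inf_enat_def)
  ultimately have "enat J \<in> enat ` S"
    unfolding Inf_enat_def by (metis LeastI_ex ex_in_conv)
  then show "\<forall>i<J. gd_iter f l x0 i \<in> X" "f (gd_iter f l x0 J) - f xstar \<le> ereal (\<delta> / 2)"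
    by (auto simp: S_def)
qed

lemma k_GD_le:
  assumes "\<forall>i<j. gd_iter f l x0 i \<in> X" "f (gd_iter f l x0 j) - f xstar \<le> ereal (\<delta> / 2)"
  shows "k_GD f l xstar x0 \<delta> \<le> enat j"
  unfolding k_GD_def using assms by (intro INF_lower) auto

end

text \<open>The phase 2 part of \<open>k_total\<close>, split off because it grows with
  \<open>\<delta>\<close> while the phase 1 count falls.\<close>

definition agd_log_term :: "(real \<Rightarrow> real) \<Rightarrow> real \<Rightarrow> real \<Rightarrow> ereal"
  where "agd_log_term l R \<delta> = max (1 + ereal (1 / 2) * elog (3 / 2) (\<delta> / (8 * l 0 * R\<^sup>2))) 0"

lemma k_total_alt:
  "k_total f l xstar x0 R \<delta> = agd_log_term l R \<delta> + ereal_of_enat (k_GD f l xstar x0 \<delta>)"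
  by (simp add: k_total_def agd_log_term_def)

lemma agd_log_term_mono:
  assumes "0 < l 0" "0 \<le> x" "x \<le> y"
  shows "agd_log_term l R x \<le> agd_log_term l R y"
proof -
  have 1: "0 \<le> x / (8 * l 0 * R\<^sup>2)" "x / (8 * l 0 * R\<^sup>2) \<le> y / (8 * l 0 * R\<^sup>2)"
    using assms by (auto intro!: divide_right_mono)
  have "elog (3 / 2) (x / (8 * l 0 * R\<^sup>2)) \<le> elog (3 / 2) (y / (8 * l 0 * R\<^sup>2))"
    unfolding elog_def using 1 by (auto intro!: log_mono simp del: divide_eq_0_iff)
  then have "ereal (1 / 2) * elog (3 / 2) (x / (8 * l 0 * R\<^sup>2))
      \<le> ereal (1 / 2) * elog (3 / 2) (y / (8 * l 0 * R\<^sup>2))"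
    by (rule ereal_mult_left_mono) simp
  then show ?thesis
    unfolding agd_log_term_def by (intro max.mono add_mono) auto
qed

text \<open>The value \<open>-\<infinity>\<close> of \<open>elog\<close> at 0 is absorbed by
  \<open>max\<close>, so only the phase 1 count remains.\<close>

lemma agd_log_term_0 [simp]: "agd_log_term l R 0 = 0"
  by (simp add: agd_log_term_def elog_def max_def)

lemma agd_log_term_pos:
  assumes "0 < l 0" "0 < R" "0 < \<delta>"
  shows "agd_log_term l R \<delta> = ereal (max (1 + 1 / 2 * log (3 / 2) (\<delta> / (8 * l 0 * R\<^sup>2))) 0)"
  using assms by (simp add: agd_log_term_def elog_def one_ereal_def zero_ereal_def ereal_max[symmetric] del: ereal_max)

section \<open>Minimizing over \<delta>, and the total count\<close>

context ell_smooth_convex_min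
begin

lemma agd_log_term_real:
  assumes "0 \<le> \<delta>" "0 < R"
  obtains c where "agd_log_term l R \<delta> = ereal c" "0 \<le> c"
proof (cases "\<delta> = 0")
  case False
  then show ?thesis
    using assms l_pos[of 0] by (intro that[OF agd_log_term_pos]) auto
qed (use that[of 0] in \<open>simp add: zero_ereal_def\<close>)

text \<open>\<open>k_GD\<close> asks only the earlier iterates to be in the domain; the last one is
  there too because its function gap is finite.\<close>

lemma k_GD_attained_in_dom:
  assumes "k_GD f l xstar x0 \<delta> = enat J"
  shows "\<forall>i<J. gd_iter f l x0 i \<in> X" "gd_iter f l x0 J \<in> X"
    "F (gd_iter f l x0 J) - F xstar \<le> \<delta> / 2"
proof -
  note att = k_GD_attained[OF assms]
  show in_X: "gd_iter f l x0 J \<in> X"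
    using att(2) f_eq_ereal[OF xstar_in_dom]
    by (cases "f (gd_iter f l x0 J)"; cases "f xstar") (auto simp: eff_dom_def)
  show "\<forall>i<J. gd_iter f l x0 i \<in> X" "F (gd_iter f l x0 J) - F xstar \<le> \<delta> / 2"
    using att f_diff_xstar[OF in_X] by auto
qed

text \<open>The phase 1 count is a decreasing step function of \<open>\<delta>\<close> that is constant to the right of
  each jump, and \<open>Q_set\<close> is downward closed. So every \<open>\<delta>\<close> can be lowered to the nearest jump,
  and below any given value of \<open>k_total\<close> only finitely many jumps compete.\<close>

lemma k_total_is_arg_min_ex:
  assumes "0 \<le> \<Delta>" "0 < R"
  shows "\<exists>\<delta>. is_arg_min (k_total f l xstar x0 R) (\<lambda>\<delta>. \<delta> \<in> Q_set l \<Delta> M) \<delta>"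
proof (cases "\<exists>\<delta>\<in>Q_set l \<Delta> M. k_total f l xstar x0 R \<delta> \<noteq> \<infinity>")
  case False
  then have "is_arg_min (k_total f l xstar x0 R) (\<lambda>\<delta>. \<delta> \<in> Q_set l \<Delta> M) 0"
    using zero_in_Q_set[OF assms(1)] by (force simp: is_arg_min_def)
  then show ?thesis ..
next
  case True
  define k where "k = k_total f l xstar x0 R"
  \<comment> \<open>\<open>jump j\<close> is the smallest \<open>\<delta>\<close> for which iterate
    \<open>j\<close> passes the test with \<open>\<delta> / 2\<close>.\<close>
  define jump where "jump j = 2 * (F (gd_iter f l x0 j) - F xstar)" for j
  have lower: "\<exists>j. jump j \<in> Q_set l \<Delta> M \<and> k (jump j) \<le> k \<delta> \<and> ereal (real j) \<le> k \<delta>"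
    if \<delta>: "\<delta> \<in> Q_set l \<Delta> M" "k \<delta> \<noteq> \<infinity>" for \<delta>
  proof -
    have "0 \<le> \<delta>" using \<delta> by (simp add: Q_set_def)
    obtain c where c: "agd_log_term l R \<delta> = ereal c" "0 \<le> c"
      using agd_log_term_real[OF \<open>0 \<le> \<delta>\<close> assms(2)] .
    obtain j where j: "k_GD f l xstar x0 \<delta> = enat j"
      using \<delta>(2) by (cases "k_GD f l xstar x0 \<delta>") (auto simp: k_def k_total_alt)
    note att = k_GD_attained_in_dom[OF j]
    have jump: "0 \<le> jump j" "jump j \<le> \<delta>"
      using att(3) F_xstar_le[OF att(2)] by (auto simp: jump_def)
    have "k_GD f l xstar x0 (jump j) \<le> enat j"
      using att f_diff_xstar[OF att(2)] by (intro k_GD_le) (auto simp: jump_def)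
    then have "k (jump j) \<le> k \<delta>"
      unfolding k_def k_total_alt j using jump l_pos[of 0]
      by (intro add_mono agd_log_term_mono) (auto simp del: ereal_of_enat_simps)
    moreover have "ereal (real j) \<le> k \<delta>"
      using c by (simp add: k_def k_total_alt j)
    ultimately show ?thesis
      using Q_set_downward[OF \<delta>(1) jump] by blast
  qed
  obtain \<delta>0 where \<delta>0: "\<delta>0 \<in> Q_set l \<Delta> M" "k \<delta>0 \<noteq> \<infinity>"
    using True by (auto simp: k_def)
  obtain n :: nat where n: "k \<delta>0 \<le> ereal (real n)"
  proof (cases "k \<delta>0")
    case (real r)
    then show ?thesis
      using that real_arch_simple[of r] by auto
  qed (use \<delta>0(2) that[of 0] in auto)
  \<comment> \<open>A competitor with value at most \<open>k \<delta>0\<close> leads to an index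
    \<open>j \<le> n\<close>, since \<open>j\<close> is itself a lower bound for that value.\<close>
  define N where "N = {j. j \<le> n \<and> jump j \<in> Q_set l \<Delta> M}"
  have "finite N"
    by (simp add: N_def)
  have lower_N: "\<exists>j\<in>N. k (jump j) \<le> k \<delta>" if "\<delta> \<in> Q_set l \<Delta> M" "k \<delta> \<le> k \<delta>0" for \<delta>
  proof -
    have "k \<delta> \<noteq> \<infinity>"
      using that(2) \<delta>0(2) by auto
    from lower[OF that(1) this] obtain j where j:
      "jump j \<in> Q_set l \<Delta> M" "k (jump j) \<le> k \<delta>" "ereal (real j) \<le> k \<delta>" by blast
    have "ereal (real j) \<le> ereal (real n)"
      using j(3) that(2) n by (meson order_trans)
    then show ?thesis
      using j by (auto simp: N_def)
  qed
  have "N \<noteq> {}"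
    using lower_N[OF \<delta>0(1)] by auto
  from ex_is_arg_min_if_finite[OF \<open>finite N\<close> this, of "\<lambda>j. k (jump j)"]
  obtain j where j: "j \<in> N" "\<And>i. i \<in> N \<Longrightarrow> k (jump j) \<le> k (jump i)"
    by (auto simp: is_arg_min_linorder)
  have "k (jump j) \<le> k \<delta>" if "\<delta> \<in> Q_set l \<Delta> M" for \<delta>
  proof (cases "k \<delta> \<le> k \<delta>0")
    case True
    then show ?thesis
      using lower_N[OF that] j(2) by (meson order_trans)
  next
    case False
    then show ?thesis
      using lower_N[OF \<delta>0(1)] j(2) by (meson order_trans nle_le order_refl)
  qed
  then have "is_arg_min k (\<lambda>\<delta>. \<delta> \<in> Q_set l \<Delta> M) (jump j)"
    using j(1) by (auto simp: is_arg_min_linorder N_def)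
  then show ?thesis
    unfolding k_def ..
qed

lemma alg_oracle_complexity_le:
  assumes R: "R = norm (x0 - xstar)" "0 < R" and eps: "0 < \<epsilon>"
    and M: "\<And>x. f x - f xstar \<le> ereal \<Delta> \<Longrightarrow> norm (x - xstar) \<le> 2 * R \<Longrightarrow> norm (grad f x) \<le> M"
    and \<delta>: "\<delta> \<in> Q_set l \<Delta> M"
    and n: "ereal (5 * sqrt (l 0) * R / sqrt \<epsilon>) + k_total f l xstar x0 R \<delta> \<le> ereal_of_enat n"
  shows "alg_oracle_complexity f l xstar x0 \<delta> R \<epsilon> \<le> n"
proof (cases n)
  case (enat m)
  have \<delta>_bounds: "0 \<le> \<delta>" "\<delta> \<le> \<Delta>"
    using \<delta> by (auto simp: Q_set_def)
  define B where "B = 5 * sqrt (l 0) * R / sqrt \<epsilon>"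
  have "0 < l 0" by (simp add: l_pos)
  then have "0 \<le> B"
    using R eps by (simp add: B_def)
  obtain c where c: "agd_log_term l R \<delta> = ereal c" "0 \<le> c"
    using agd_log_term_real[OF \<delta>_bounds(1) R(2)] .
  have "ereal B + (ereal c + ereal_of_enat (k_GD f l xstar x0 \<delta>)) \<le> ereal (real m)"
    using n by (simp add: B_def k_total_alt c enat)
  then obtain J where J: "k_GD f l xstar x0 \<delta> = enat J" "B + c + real J \<le> real m"
    by (cases "k_GD f l xstar x0 \<delta>") auto
  note att = k_GD_attained_in_dom[OF J(1)]
  define xbar where "xbar = gd_iter f l x0 J"
  have complexity_le: "alg_oracle_complexity f l xstar x0 \<delta> R \<epsilon> \<le> enat (J + K)"
    if "\<forall>k<K. agd_iter f l \<delta> R xbar k \<in> X" "eps_solution f \<epsilon> (agd_iter f l \<delta> R xbar K)" for K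
  proof -
    have "alg_oracle_complexity f l xstar x0 \<delta> R \<epsilon> \<le> (case (J, K) of (J, K) \<Rightarrow> enat (J + K))"
      unfolding alg_oracle_complexity_def using that J(1)
      by (intro INF_lower) (auto simp: xbar_def)
    then show ?thesis by simp
  qed
  show ?thesis
  proof (cases "\<delta> = 0")
    case True
    have "eps_solution f \<epsilon> (agd_iter f l \<delta> R xbar 0)"
      using att(2,3) True eps by (intro eps_solutionI) (auto simp: agd_iter_def xbar_def)
    then have "alg_oracle_complexity f l xstar x0 \<delta> R \<epsilon> \<le> enat (J + 0)"
      by (intro complexity_le) auto
    also have "\<dots> \<le> enat m"
      using J(2) \<open>0 \<le> B\<close> c by simp
    finally show ?thesis by (simp add: enat)
  next
    case False
    then have "0 < \<delta>" using \<delta>_bounds by simp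
    have dist: "norm (xbar - xstar) \<le> R"
      unfolding xbar_def R(1) by (rule gd_iter_dist_le[OF att(1)])
    have "f xbar - f xstar \<le> ereal \<Delta>"
      using att(3) f_diff_xstar[OF att(2)] \<delta>_bounds by (simp add: xbar_def)
    then have grad: "norm (grad f xbar) \<le> M"
      using dist R(2) by (intro M) auto
    \<comment> \<open>After the \<open>J\<close> gradients of phase 1, the remaining
      \<open>m - J\<close> of the budget go to phase 2.\<close>
    have "J \<le> m" "B + c \<le> real (m - J)"
      using J(2) \<open>0 \<le> B\<close> c by (auto simp: of_nat_diff)
    have "B + max (1 + 1 / 2 * log (3 / 2) (\<delta> / (8 * l 0 * R\<^sup>2))) 0 \<le> real (m - J)"
      using \<open>B + c \<le> _\<close> c(1) agd_log_term_pos[of l, OF \<open>0 < l 0\<close> R(2) \<open>0 < \<delta>\<close>]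
      by (metis ereal.inject)
    note run = agd_reaches_eps[OF att(2)[folded xbar_def] dist att(3)[folded xbar_def] grad \<open>0 < \<delta>\<close> R(2) eps \<delta> this[unfolded B_def]]
    have "alg_oracle_complexity f l xstar x0 \<delta> R \<epsilon> \<le> enat (J + (m - J))"
      using run by (intro complexity_le) auto
    then show ?thesis
      using \<open>J \<le> m\<close> by (simp add: enat)
  qed
qed simp

end

text \<open>The \<open>LEAST\<close> is attained since \<open>enat\<close> is well-ordered and
  infinity is admissible.\<close>

lemma le_round_upI:
  assumes "\<And>n. b \<le> ereal_of_enat n \<Longrightarrow> c \<le> n"
  shows "c \<le> round_up b"
  unfolding round_up_def
proof (rule assms, rule LeastI)
  show "b \<le> ereal_of_enat \<infinity>" by simp
qed

theorem corollary5p3: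
  fixes f :: "real ^ 'n \<Rightarrow> ereal" and l :: "real \<Rightarrow> real"
    and xstar x0 :: "real ^ 'n" and \<Delta> R M \<epsilon> :: real
  assumes proper: "\<And>x. f x \<noteq> -\<infinity>"
    and dom: "open (eff_dom f)" "convex (eff_dom f)" "eff_dom f \<noteq> {}"
    and convex: "convex_on (eff_dom f) (\<lambda>x. real_of_ereal (f x))"
    and smooth: "ell_smooth l f"
    and minimum: "\<And>x. f xstar \<le> f x"
    and start: "x0 \<in> eff_dom f"
    and Delta: "ereal \<Delta> = f x0 - f xstar"
    and R: "R = norm (x0 - xstar)" "R > 0"
    and M: "\<And>x. f x - f xstar \<le> ereal \<Delta> \<Longrightarrow> norm (x - xstar) \<le> 2 * R \<Longrightarrow> norm (grad f x) \<le> M"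
    and eps: "\<epsilon> > 0"
  shows "(\<exists>\<delta>. is_arg_min (k_total f l xstar x0 R) (\<lambda>\<delta>. \<delta> \<in> Q_set l \<Delta> M) \<delta>) \<and>
    (\<forall>\<delta>. is_arg_min (k_total f l xstar x0 R) (\<lambda>\<delta>. \<delta> \<in> Q_set l \<Delta> M) \<delta> \<longrightarrow>
      alg_oracle_complexity f l xstar x0 \<delta> R \<epsilon>
        \<le> round_up (ereal (5 * sqrt (l 0) * R / sqrt \<epsilon>)
            + (INF \<delta>'\<in>Q_set l \<Delta> M. k_total f l xstar x0 R \<delta>')))"
proof -
  interpret ell_smooth_convex_min f l xstar
    using proper dom convex smooth minimum by unfold_locales
  have "ereal \<Delta> = ereal (F x0 - F xstar)"
    unfolding Delta by (rule f_diff_xstar[OF start])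
  then have "0 \<le> \<Delta>"
    using F_xstar_le[OF start] by simp
  have "alg_oracle_complexity f l xstar x0 \<delta> R \<epsilon>
        \<le> round_up (ereal (5 * sqrt (l 0) * R / sqrt \<epsilon>)
            + (INF \<delta>'\<in>Q_set l \<Delta> M. k_total f l xstar x0 R \<delta>'))"
    if "is_arg_min (k_total f l xstar x0 R) (\<lambda>\<delta>. \<delta> \<in> Q_set l \<Delta> M) \<delta>" for \<delta>
  proof -
    have \<delta>: "\<delta> \<in> Q_set l \<Delta> M"
      "\<And>\<delta>'. \<delta>' \<in> Q_set l \<Delta> M \<Longrightarrow> k_total f l xstar x0 R \<delta> \<le> k_total f l xstar x0 R \<delta>'"
      using that by (auto simp: is_arg_min_linorder)
    then have "(INF \<delta>'\<in>Q_set l \<Delta> M. k_total f l xstar x0 R \<delta>') = k_total f l xstar x0 R \<delta>"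
      by (intro antisym INF_lower INF_greatest)
    then show ?thesis
      using alg_oracle_complexity_le[OF R eps M \<delta>(1)] by (auto intro: le_round_upI)
  qed
  then show ?thesis
    using k_total_is_arg_min_ex[OF \<open>0 \<le> \<Delta>\<close> R(2)] by blast
qed

end
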